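(* Let $1\le p_1,p_2\le p\le2$ and $p_3\ge p'$ (where $1/p+1/p'=1$) be such that $\frac1{p_1}+\frac1{p_2}-\frac2p=\frac1{p_3}$. If $m\in L^p(\mathbb R^2)$ then $m\in\mathcal{BM}_{(p_1,p_2,p_3)}(\mathbb R)$.
   Context: The Fourier transform is $\hat f(\xi)=\int_{\mathbb R}f(x)e^{-2\pi i x\xi}dx$. $\mathcal P(\mathbb R)$ denotes the set of Schwartz functions on $\mathbb R$ whose Fourier transform is continuous with compact support. For $1\le p_1,p_2\le\infty$, $0<p_3\le\infty$ and $m\in L^1_{loc}(\mathbb R^2)$, set, for $f,g\in\mathcal P(\mathbb R)$, $B_m(f,g)(x)=\int_{\mathbb R}\int_{\mathbb R}\hat f(\xi)\hat g(\eta)m(\xi,\eta)e^{2\pi i(\xi+\eta)x}d\xi\,d\eta$. One writes $m\in\mathcal{BM}_{(p_1,p_2,p_3)}(\mathbb R)$ if there is $C>0$ with $\|B_m(f,g)\|_{p_3}\le C\|f\|_{p_1}\|g\|_{p_2}$ for all $f,g\in\mathcal P(\mathbb R)$ (with $C_0(\mathbb R)$ in place of $L^\infty$ when an exponent $p_1$ or $p_2$ equals $\infty$). *)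

theory Defs
  imports "HOL-Analysis.Analysis"
begin

definition fourier :: "(real \<Rightarrow> complex) \<Rightarrow> real \<Rightarrow> complex" where
  "fourier f \<xi> = (LINT x|lborel. f x * exp (- (2 * of_real pi * \<i> * of_real x * of_real \<xi>)))"

fun nth_deriv :: "nat \<Rightarrow> (real \<Rightarrow> complex) \<Rightarrow> real \<Rightarrow> complex" where
  "nth_deriv 0 f = f"
| "nth_deriv (Suc k) f = (\<lambda>x. vector_derivative (nth_deriv k f) (at x))"

definition schwartz :: "(real \<Rightarrow> complex) \<Rightarrow> bool" where
  "schwartz f \<longleftrightarrow>
     (\<forall>k x. (nth_deriv k f has_vector_derivative nth_deriv (Suc k) f x) (at x)) \<and>
     (\<forall>k n. \<exists>C. \<forall>x. \<bar>x\<bar> ^ n * norm (nth_deriv k f x) \<le> C)"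

definition P_class :: "(real \<Rightarrow> complex) set" where
  "P_class = {f. schwartz f \<and> continuous_on UNIV (fourier f) \<and>
                 compact (closure {\<xi>. fourier f \<xi> \<noteq> 0})}"

definition Lp_norm :: "ennreal \<Rightarrow> ('a \<Rightarrow> 'b::real_normed_vector) \<Rightarrow> 'a measure \<Rightarrow> ennreal" where
  "Lp_norm q f M =
     (if q = \<infinity> then Inf {C. AE x in M. ennreal (norm (f x)) \<le> C}
      else (let I = (\<integral>\<^sup>+ x. ennreal (norm (f x) powr enn2real q) \<partial>M)
            in if I = \<infinity> then \<infinity> else ennreal (enn2real I powr (1 / enn2real q))))"

definition in_Lp2 :: "ennreal \<Rightarrow> (real \<times> real \<Rightarrow> complex) \<Rightarrow> bool" where
  "in_Lp2 q m \<longleftrightarrow> m \<in> borel_measurable lebesgue \<and> Lp_norm q m lebesgue < \<infinity>"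

definition bilin_op :: "(real \<times> real \<Rightarrow> complex) \<Rightarrow> (real \<Rightarrow> complex) \<Rightarrow> (real \<Rightarrow> complex) \<Rightarrow> real \<Rightarrow> complex" where
  "bilin_op m f g x = (LINT z|lebesgue. fourier f (fst z) * fourier g (snd z) * m z *
       exp (2 * of_real pi * \<i> * of_real (fst z + snd z) * of_real x))"

definition BM :: "ennreal \<Rightarrow> ennreal \<Rightarrow> ennreal \<Rightarrow> (real \<times> real \<Rightarrow> complex) \<Rightarrow> bool" where
  "BM p1 p2 p3 m \<longleftrightarrow>
     (\<exists>C::real. C > 0 \<and> (\<forall>f\<in>P_class. \<forall>g\<in>P_class.
        Lp_norm p3 (bilin_op m f g) lebesgue \<le> ennreal C * Lp_norm p1 f lebesgue * Lp_norm p2 g lebesgue))"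

definition conj_exp :: "real \<Rightarrow> ennreal" where
  "conj_exp p = (if p = 1 then \<infinity> else ennreal (p / (p - 1)))"

end

(* With F(t) the integral over \<xi> of f^(\<xi>) g^(t - \<xi>) m(\<xi>, t - \<xi>), the function B_m(f, g) is the inverse
   Fourier transform of F, so for finite p3 Hausdorff-Young with exponent q = p3' bounds it by the L^q norm
   of F (for p3 = \<infinity> take q = 1).  Hoelder gives |F| \<le> (|f^|^p' * |g^|^p')^(1/p') M with M in L^p, and
   Young's convolution inequality together with Hausdorff-Young for f and g finishes the estimate.
   No sharp constants are needed, so Hausdorff-Young is obtained by Marcinkiewicz interpolation between
   the trivial L^1 bound and the Plancherel inequality, which comes from Gaussian regularisation. *)

theory Submission
  imports Defs "HOL-Probability.Probability"
begin

section \<open>Plancherel inequality\<close>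

text \<open>Every L^s bound is carried as a pointwise majorant
  \<open>norm (F t) \<le> N * h t powr (1 / s)\<close> with \<open>unit_mass h\<close>. Hoelder and
  Young then both reduce to the single inequality \<open>weighted_am_gm_4\<close>, and s = infinity
  is simply the exponent 0. Put \<alpha> = 1 - 1/p1, \<beta> = 1 - 1/p2, \<pi> = 1/p, \<sigma> =
  1/p3 and \<rho> = 1 - 1/p - \<sigma>. The scaling relation becomes \<alpha> + \<beta> + \<pi> = 1
  + \<rho>. Given it, \<rho> \<ge> 0 means p3 \<ge> p', while \<rho> \<le> \<alpha> and \<rho> \<le>
  \<beta> mean p2 \<le> p and p1 \<le> p. The exponent that comes out of the convolution is \<rho> +
  \<pi> = 1 - \<sigma>, from which Hausdorff-Young leads to L^p3. Plancherel is required only as an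
  inequality for integrable functions. Fatou's lemma removes the Gaussian weight, so neither an L^2
  extension of the transform nor convergence of approximate identities enters.\<close>

lemma integrable_mult_pair_bounded:
  fixes f h :: "real \<Rightarrow> complex" and u :: "real \<times> real \<Rightarrow> complex"
  assumes f: "integrable lborel f" and h: "integrable lborel h"
    and u [measurable]: "u \<in> borel_measurable (lborel \<Otimes>\<^sub>M lborel)"
    and bd: "\<And>z. norm (u z) \<le> C"
  shows "integrable (lborel \<Otimes>\<^sub>M lborel) (\<lambda>(x, y). f x * h y * u (x, y))"
proof (rule lborel_pair.Fubini_integrable)
  have [measurable]: "f \<in> borel_measurable borel" "h \<in> borel_measurable borel"
    using f h by (auto dest: borel_measurable_integrable)
  have C: "0 \<le> C" using bd[of undefined] norm_ge_zero order_trans by blast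
  have bd': "norm (f x * h y * u (x, y)) \<le> norm (f x) * (C * norm (h y))" for x y
    using mult_left_mono[OF bd[of "(x, y)"], of "norm (f x) * norm (h y)"] by (simp add: norm_mult mult_ac)
  have u' [measurable]: "case_prod (\<lambda>x y. u (x, y)) \<in> borel_measurable (lborel \<Otimes>\<^sub>M lborel)"
    using u by simp
  show m: "(\<lambda>(x, y). f x * h y * u (x, y)) \<in> borel_measurable (lborel \<Otimes>\<^sub>M lborel)"
    by measurable
  have um: "(\<lambda>y. u (x, y)) \<in> borel_measurable borel" for x
    using measurable_compose[OF measurable_Pair1' u, of x] by simp
  have um' [measurable]: "(\<lambda>y. f x * h y * u (x, y)) \<in> borel_measurable borel" for x
    using um[of x] by measurable
  have int: "integrable lborel (\<lambda>y. f x * h y * u (x, y))" for x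
  proof (rule Bochner_Integration.integrable_bound)
    show "integrable lborel (\<lambda>y. norm (f x) * (C * norm (h y)))"
      using h by auto
    show "AE y in lborel. norm (f x * h y * u (x, y)) \<le> norm (norm (f x) * (C * norm (h y)))"
      using C by (intro AE_I2 order_trans[OF bd']) (simp add: abs_mult)
  qed simp
  then show "AE x in lborel. integrable lborel (\<lambda>y. case (x, y) of (x, y) \<Rightarrow> f x * h y * u (x, y))"
    by simp
  show "integrable lborel (\<lambda>x. LINT y|lborel. norm (case (x, y) of (x, y) \<Rightarrow> f x * h y * u (x, y)))"
  proof (rule Bochner_Integration.integrable_bound)
    show "integrable lborel (\<lambda>x. norm (f x) * (LINT y|lborel. C * norm (h y)))"
      using f by auto
    show "(\<lambda>x. LINT y|lborel. norm (case (x, y) of (x, y) \<Rightarrow> f x * h y * u (x, y)))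
       \<in> borel_measurable lborel"
      using m by measurable
    have "(LINT y|lborel. norm (f x * h y * u (x, y))) \<le> norm (f x) * (LINT y|lborel. C * norm (h y))" for x
    proof -
      have "(LINT y|lborel. norm (f x * h y * u (x, y))) \<le> (LINT y|lborel. norm (f x) * (C * norm (h y)))"
      proof (intro integral_mono integrable_norm int)
        show "integrable lborel (\<lambda>y. norm (f x) * (C * norm (h y)))" using h by auto
        show "norm (f x * h y * u (x, y)) \<le> norm (f x) * (C * norm (h y))" for y
          by (rule bd')
      qed
      then show ?thesis by simp
    qed
    then show "AE x in lborel. norm (LINT y|lborel. norm (case (x, y) of (x, y) \<Rightarrow> f x * h y * u (x, y)))
       \<le> norm (norm (f x) * (LINT y|lborel. C * norm (h y)))"
      using C by (intro AE_I2) (auto simp: abs_mult)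
  qed
qed

section \<open>Elementary bounds for the Fourier transform\<close>

lemma norm_fourier_kernel:
  "norm (exp (- (2 * of_real pi * \<i> * of_real x * of_real \<xi>)) :: complex) = 1"
  using norm_exp_i_times[of "- (2 * pi * x * \<xi>)"] by (simp add: mult_ac)

lemma fourier_measurable:
  assumes [measurable]: "f \<in> borel_measurable borel"
  shows "fourier f \<in> borel_measurable borel"
proof -
  have "(\<lambda>\<xi>. LINT x|lborel. f x * exp (- (2 * of_real pi * \<i> * of_real x * of_real \<xi>)))
        \<in> borel_measurable lborel"
    by measurable
  then show ?thesis by (simp add: fourier_def[abs_def])
qed

lemma integrable_fourier_kernel:
  assumes "integrable lborel f"
  shows "integrable lborel (\<lambda>x. f x * exp (- (2 * of_real pi * \<i> * of_real x * of_real \<xi>)))"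
proof (rule Bochner_Integration.integrable_bound[OF assms])
  have [measurable]: "f \<in> borel_measurable borel"
    using assms by (auto dest: borel_measurable_integrable)
  show "(\<lambda>x. f x * exp (- (2 * of_real pi * \<i> * of_real x * of_real \<xi>))) \<in> borel_measurable lborel"
    by measurable
qed (simp add: norm_mult norm_fourier_kernel)

lemma fourier_cmult: "fourier (\<lambda>x. c * f x) \<xi> = c * fourier f \<xi>"
  by (simp add: fourier_def mult.assoc)

lemma fourier_add:
  assumes "integrable lborel f" "integrable lborel g"
  shows "fourier (\<lambda>x. f x + g x) \<xi> = fourier f \<xi> + fourier g \<xi>"
  using Bochner_Integration.integral_add[OF assms[THEN integrable_fourier_kernel], of \<xi> \<xi>]
  by (simp add: fourier_def distrib_right)

lemma norm_fourier_le: "norm (fourier f \<xi>) \<le> (LINT x|lborel. norm (f x))"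
  unfolding fourier_def
  by (rule order_trans[OF integral_norm_bound]) (simp add: norm_mult norm_fourier_kernel)

text \<open>Integrability is not assumed: a non-integrable function has Bochner integral 0 by
  convention, and the bound is then trivial.\<close>

lemma ennreal_norm_integral_le:
  fixes f :: "'a \<Rightarrow> 'b::{banach, second_countable_topology}"
  shows "ennreal (norm (LINT x|M. f x)) \<le> (\<integral>\<^sup>+x. ennreal (norm (f x)) \<partial>M)"
  by (cases "integrable M f") (auto simp: integral_norm_bound_ennreal not_integrable_integral_eq)

lemma ennreal_norm_fourier_le: "ennreal (norm (fourier f \<xi>)) \<le> (\<integral>\<^sup>+x. ennreal (norm (f x)) \<partial>lborel)"
  unfolding fourier_def
  by (rule order_trans[OF ennreal_norm_integral_le]) (simp add: norm_mult norm_fourier_kernel)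

text \<open>A rescaling of the known characteristic function of the standard normal distribution.
  The transform is expressed as a probability density because its total mass 1 is what the
  Plancherel estimate exploits.\<close>

lemma fourier_gaussian:
  assumes s: "\<sigma> > 0"
  shows "fourier (\<lambda>\<xi>. of_real (exp (- (\<sigma> * \<xi>)\<^sup>2 / 2))) u = of_real (normal_density 0 (\<sigma> / (2 * pi)) u)"
proof -
  \<comment> \<open>Chosen so that \<open>t * (\<sigma> * x)\<close> is the Fourier phase -2 pi x
    u.\<close>
  define t where "t = - (2 * pi * u / \<sigma>)"
  have "complex_of_real (exp (- t\<^sup>2 / 2)) = char std_normal_distribution t"
    by (simp add: char_std_normal_distribution)
  also have "\<dots> = (LINT x|lborel. std_normal_density x *\<^sub>R iexp (t * x))"
    unfolding char_def by (subst integral_density) (auto simp: normal_density_nonneg)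
  also have "\<dots> = \<sigma> *\<^sub>R (LINT x|lborel. std_normal_density (\<sigma> * x) *\<^sub>R iexp (t * (\<sigma> * x)))"
    using s by (subst lborel_integral_real_affine[where c = \<sigma> and t = 0]) auto
  also have "(LINT x|lborel. std_normal_density (\<sigma> * x) *\<^sub>R iexp (t * (\<sigma> * x)))
    = (LINT x|lborel. of_real (1 / sqrt (2 * pi)) * (of_real (exp (- (\<sigma> * x)\<^sup>2 / 2)) * exp (- (2 * of_real pi * \<i> * of_real x * of_real u))))"
  proof (intro Bochner_Integration.integral_cong refl)
    fix x
    have "t * (\<sigma> * x) = - (2 * pi * x * u)" using s by (simp add: t_def)
    then have "iexp (t * (\<sigma> * x)) = exp (- (2 * of_real pi * \<i> * of_real x * of_real u))"
      by (simp add: mult_ac)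
    then show "std_normal_density (\<sigma> * x) *\<^sub>R iexp (t * (\<sigma> * x)) =
      of_real (1 / sqrt (2 * pi)) * (of_real (exp (- (\<sigma> * x)\<^sup>2 / 2)) * exp (- (2 * of_real pi * \<i> * of_real x * of_real u)))"
      by (simp add: std_normal_density_def scaleR_conv_of_real)
  qed
  also have "\<dots> = of_real (1 / sqrt (2 * pi)) * fourier (\<lambda>\<xi>. of_real (exp (- (\<sigma> * \<xi>)\<^sup>2 / 2))) u"
    by (subst integral_mult_right_zero) (simp add: fourier_def)
  finally have "fourier (\<lambda>\<xi>. of_real (exp (- (\<sigma> * \<xi>)\<^sup>2 / 2))) u
      = of_real (sqrt (2 * pi) / \<sigma> * exp (- t\<^sup>2 / 2))"
    using s by (simp add: scaleR_conv_of_real field_simps)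
  also have "sqrt (2 * pi) / \<sigma> * exp (- t\<^sup>2 / 2) = normal_density 0 (\<sigma> / (2 * pi)) u"
  proof -
    have "sqrt (2 * pi * (\<sigma> / (2 * pi))\<^sup>2) = sqrt (2 * pi) * (\<sigma> / (2 * pi))"
      using s by (simp add: real_sqrt_mult)
    moreover have "sqrt (2 * pi) / \<sigma> = 1 / (sqrt (2 * pi) * (\<sigma> / (2 * pi)))"
      using s by (simp add: field_simps flip: real_sqrt_mult)
    moreover have "- t\<^sup>2 / 2 = - (u - 0)\<^sup>2 / (2 * (\<sigma> / (2 * pi))\<^sup>2)"
      using s by (simp add: t_def field_simps power2_eq_square)
    ultimately show ?thesis by (simp add: normal_density_def)
  qed
  finally show ?thesis .
qed

lemma cnj_fourier:
  "cnj (fourier f \<xi>) = (LINT y|lborel. cnj (f y) * exp (2 * of_real pi * \<i> * of_real y * of_real \<xi>))"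
  unfolding fourier_def by (simp add: exp_cnj mult_ac flip: Bochner_Integration.integral_cnj)

lemma nn_integral_normal_density_shift:
  assumes "0 < \<sigma>"
  shows "(\<integral>\<^sup>+y. ennreal (normal_density 0 \<sigma> (x - y)) \<partial>lborel) = 1"
proof -
  have "(\<integral>\<^sup>+y. ennreal (normal_density 0 \<sigma> y) \<partial>lborel) = 1"
    using assms by (subst nn_integral_eq_integral) auto
  then show ?thesis
    using nn_integral_real_affine[of "\<lambda>y. ennreal (normal_density 0 \<sigma> y)" "-1" x] by simp
qed

text \<open>Both transforms are expanded into integrals and the frequency integral is carried out
  first; it is the transform of the Gaussian at x - y. A transform of an integrable function is only
  known to be bounded, so the Gaussian weight is what makes the two interchanges legitimate.\<close>

lemma gaussian_weighted_plancherel: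
  assumes f: "integrable lborel f" and s: "\<sigma> > 0"
  shows "(LINT \<xi>|lborel. fourier f \<xi> * (cnj (fourier f \<xi>) * of_real (exp (- (\<sigma> * \<xi>)\<^sup>2 / 2)))) =
    (LINT x|lborel. f x * (LINT y|lborel. cnj (f y) * of_real (normal_density 0 (\<sigma> / (2 * pi)) (x - y))))"
proof -
  let ?e = "\<lambda>x \<xi>. exp (- (2 * of_real pi * \<i> * of_real x * of_real \<xi>)) :: complex"
  define k :: "real \<Rightarrow> complex" where "k \<xi> = of_real (exp (- (\<sigma> * \<xi>)\<^sup>2 / 2))" for \<xi>
  have [measurable]: "f \<in> borel_measurable borel"
    using f by (auto dest: borel_measurable_integrable)
  note [measurable] = fourier_measurable[of f]
  have k: "integrable lborel k"
  proof -
    have "integrable lborel (\<lambda>\<xi>. complex_of_real (sqrt (2 * pi) * std_normal_density (0 + \<sigma> * \<xi>)))"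
      using s by (intro integrable_of_real integrable_mult_right lborel_integrable_real_affine) auto
    then show ?thesis by (simp add: k_def[abs_def] std_normal_density_def)
  qed
  have [measurable]: "k \<in> borel_measurable borel" using k by (auto dest: borel_measurable_integrable)
  have [measurable]: "cnj \<in> borel_measurable borel"
    by (intro borel_measurable_continuous_onI continuous_on_cnj continuous_on_id)
  define h where "h \<xi> = cnj (fourier f \<xi>) * k \<xi>" for \<xi>
  have h: "integrable lborel h"
  proof (rule Bochner_Integration.integrable_bound)
    show "integrable lborel (\<lambda>\<xi>. (LINT x|lborel. norm (f x)) * norm (k \<xi>))"
      using k by auto
    show "h \<in> borel_measurable lborel" unfolding h_def[abs_def] by measurable
    show "AE \<xi> in lborel. norm (h \<xi>) \<le> norm ((LINT x|lborel. norm (f x)) * norm (k \<xi>))"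
      by (intro AE_I2) (auto simp: h_def norm_mult intro!: mult_right_mono norm_fourier_le)
  qed
  have em: "(\<lambda>z. ?e (fst z) (snd z)) \<in> borel_measurable (lborel \<Otimes>\<^sub>M lborel)"
    by measurable
  have em': "(\<lambda>z. ?e x (snd z) * exp (2 * of_real pi * \<i> * of_real (fst z) * of_real (snd z)))
    \<in> borel_measurable (lborel \<Otimes>\<^sub>M lborel)" for x
    by measurable
  \<comment> \<open>The conjugate transform contributes the opposite phase, so the two exponentials
    combine into the kernel at x - y.\<close>
  have T: "(LINT \<xi>|lborel. h \<xi> * ?e x \<xi>) =
      (LINT y|lborel. cnj (f y) * of_real (normal_density 0 (\<sigma> / (2 * pi)) (x - y)))" for x
  proof -
    have "(LINT \<xi>|lborel. h \<xi> * ?e x \<xi>) = (LINT \<xi>|lborel. (LINT y|lborel.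
        cnj (f y) * k \<xi> * (?e x \<xi> * exp (2 * of_real pi * \<i> * of_real y * of_real \<xi>))))"
      unfolding h_def cnj_fourier
      by (intro Bochner_Integration.integral_cong refl)
        (simp add: mult_ac flip: integral_mult_right_zero)
    also have "\<dots> = (LINT y|lborel. (LINT \<xi>|lborel.
        cnj (f y) * k \<xi> * (?e x \<xi> * exp (2 * of_real pi * \<i> * of_real y * of_real \<xi>))))"
    proof (rule lborel_pair.Fubini_integral)
      have "norm (?e x (snd z) * exp (2 * of_real pi * \<i> * of_real (fst z) * of_real (snd z))) \<le> 1" for z :: "real \<times> real"
        using norm_fourier_kernel[of x "snd z"] norm_fourier_kernel[of "- fst z" "snd z"]
        by (simp add: norm_mult)
      from integrable_mult_pair_bounded[OF _ k em'[of x] this, of "\<lambda>y. cnj (f y)"]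
      show "integrable (lborel \<Otimes>\<^sub>M lborel) (\<lambda>(y, \<xi>).
        cnj (f y) * k \<xi> * (?e x \<xi> * exp (2 * of_real pi * \<i> * of_real y * of_real \<xi>)))"
        using f by simp
    qed
    also have "\<dots> = (LINT y|lborel. cnj (f y) * fourier k (x - y))"
      unfolding fourier_def
      by (intro Bochner_Integration.integral_cong refl)
        (simp add: mult_ac algebra_simps flip: integral_mult_right_zero exp_add)
    finally show ?thesis using fourier_gaussian[OF s] by (simp add: k_def[abs_def])
  qed
  have "(LINT \<xi>|lborel. fourier f \<xi> * h \<xi>) = (LINT \<xi>|lborel. (LINT x|lborel. f x * h \<xi> * ?e x \<xi>))"
    unfolding fourier_def
    by (intro Bochner_Integration.integral_cong refl)
        (simp add: mult_ac flip: integral_mult_right_zero)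
  also have "\<dots> = (LINT x|lborel. (LINT \<xi>|lborel. f x * h \<xi> * ?e x \<xi>))"
    using integrable_mult_pair_bounded[OF f h em, of 1]
    by (intro lborel_pair.Fubini_integral) (simp add: norm_fourier_kernel)
  also have "\<dots> = (LINT x|lborel. f x * (LINT \<xi>|lborel. h \<xi> * ?e x \<xi>))"
    by (simp add: mult.assoc)
  finally show ?thesis unfolding T by (simp add: h_def k_def)
qed

text \<open>With the Gaussian weight the left side is a double integral of f(x), cnj f(y) and a
  probability density in x - y, hence at most the L^2 mass of f, uniformly in the weight. The right
  side may be infinite.\<close>

lemma plancherel_le:
  assumes f: "integrable lborel f"
  shows "(\<integral>\<^sup>+\<xi>. ennreal ((norm (fourier f \<xi>))\<^sup>2) \<partial>lborel) \<le> (\<integral>\<^sup>+x. ennreal ((norm (f x))\<^sup>2) \<partial>lborel)"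
    (is "_ \<le> ?A")
proof -
  have [measurable]: "f \<in> borel_measurable borel"
    using f by (auto dest: borel_measurable_integrable)
  note [measurable] = fourier_measurable[of f]
  \<comment> \<open>Gaussian weights of parameter 1/(n+1): integrable for each n, and tending to 1
    pointwise.\<close>
  define w where "w n \<xi> = exp (- (inverse (real (Suc n)) * \<xi>)\<^sup>2 / 2)" for n \<xi>
  have step: "(\<integral>\<^sup>+\<xi>. ennreal ((norm (fourier f \<xi>))\<^sup>2 * w n \<xi>) \<partial>lborel) \<le> ?A" for n
  proof -
    define \<sigma> where "\<sigma> = inverse (real (Suc n))"
    define N where "N = normal_density 0 (\<sigma> / (2 * pi))"
    have s: "\<sigma> > 0" by (simp add: \<sigma>_def)
    have N0: "N x \<ge> 0" for x by (simp add: N_def)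
    have [measurable]: "N \<in> borel_measurable borel" by (simp add: N_def)
    have N1: "(\<integral>\<^sup>+y. ennreal (N (x - y)) \<partial>lborel) = 1" for x
      using s by (simp add: N_def nn_integral_normal_density_shift)
    have N1': "(\<integral>\<^sup>+x. ennreal (N (x - y)) \<partial>lborel) = 1" for y
      using nn_integral_real_affine[of "\<lambda>y. ennreal (N y)" 1 "-y"] N1[of 0]
        nn_integral_real_affine[of "\<lambda>y. ennreal (N y)" "-1" 0] by simp
    let ?F = "\<lambda>\<xi>. (norm (fourier f \<xi>))\<^sup>2 * w n \<xi>"
    have Fint: "integrable lborel ?F"
    proof (rule Bochner_Integration.integrable_bound)
      have "integrable lborel (\<lambda>\<xi>. sqrt (2 * pi) * std_normal_density (0 + \<sigma> * \<xi>))"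
        using s by (intro integrable_mult_right lborel_integrable_real_affine) auto
      then have "integrable lborel (w n)"
        by (simp add: w_def[abs_def] \<sigma>_def std_normal_density_def)
      then show "integrable lborel (\<lambda>\<xi>. (LINT x|lborel. norm (f x))\<^sup>2 * w n \<xi>)" by simp
      show "?F \<in> borel_measurable lborel" unfolding w_def by measurable
      show "AE \<xi> in lborel. norm (?F \<xi>) \<le> norm ((LINT x|lborel. norm (f x))\<^sup>2 * w n \<xi>)"
        by (intro AE_I2) (auto simp: w_def abs_mult intro!: mult_right_mono power_mono norm_fourier_le)
    qed
    have "(\<integral>\<^sup>+\<xi>. ennreal (?F \<xi>) \<partial>lborel) = ennreal (LINT \<xi>|lborel. ?F \<xi>)"
      by (intro nn_integral_eq_integral Fint AE_I2) (simp add: w_def)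
    also have "\<dots> \<le> ennreal (norm (of_real (LINT \<xi>|lborel. ?F \<xi>) :: complex))"
      by (intro ennreal_leI) simp
    also have "(of_real (LINT \<xi>|lborel. ?F \<xi>) :: complex) =
        (LINT \<xi>|lborel. fourier f \<xi> * (cnj (fourier f \<xi>) * of_real (exp (- (\<sigma> * \<xi>)\<^sup>2 / 2))))"
      unfolding integral_complex_of_real[symmetric]
      by (intro Bochner_Integration.integral_cong refl)
        (simp only: w_def \<sigma>_def of_real_mult complex_norm_square mult.assoc)
    also have "\<dots> = (LINT x|lborel. f x * (LINT y|lborel. cnj (f y) * of_real (N (x - y))))"
      unfolding gaussian_weighted_plancherel[OF f s] N_def ..
    \<comment> \<open>From here on only nonnegative integrals occur, so Tonelli applies even if the
      L^2 mass of f is infinite.\<close>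
    also have "ennreal (norm \<dots>) \<le> (\<integral>\<^sup>+x. ennreal (norm (f x)) *
        ennreal (norm (LINT y|lborel. cnj (f y) * of_real (N (x - y)))) \<partial>lborel)"
      by (rule order_trans[OF ennreal_norm_integral_le]) (simp add: norm_mult ennreal_mult)
    also have "\<dots> \<le> (\<integral>\<^sup>+x. ennreal (norm (f x)) * (\<integral>\<^sup>+y. ennreal (norm (f y) * N (x - y)) \<partial>lborel) \<partial>lborel)"
      by (intro nn_integral_mono mult_left_mono order_trans[OF ennreal_norm_integral_le])
        (auto simp: norm_mult N0)
    also have "\<dots> = (\<integral>\<^sup>+x. (\<integral>\<^sup>+y. ennreal (norm (f x)) * ennreal (norm (f y) * N (x - y)) \<partial>lborel) \<partial>lborel)"
      by (simp add: nn_integral_cmult)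
    also have "\<dots> \<le> (\<integral>\<^sup>+x. (\<integral>\<^sup>+y. ennreal ((norm (f x))\<^sup>2 / 2) * ennreal (N (x - y)) +
        ennreal ((norm (f y))\<^sup>2 / 2) * ennreal (N (x - y)) \<partial>lborel) \<partial>lborel)"
    proof (intro nn_integral_mono)
      fix x y
      \<comment> \<open>This replaces Cauchy-Schwarz: each half depends on one variable only, and
        the density has mass 1 in the other variable.\<close>
      have "norm (f x) * norm (f y) \<le> (norm (f x))\<^sup>2 / 2 + (norm (f y))\<^sup>2 / 2"
        using sum_squares_bound[of "norm (f x)" "norm (f y)"] by simp
      from mult_right_mono[OF this N0[of "x - y"]]
      show "ennreal (norm (f x)) * ennreal (norm (f y) * N (x - y)) \<le>
        ennreal ((norm (f x))\<^sup>2 / 2) * ennreal (N (x - y)) + ennreal ((norm (f y))\<^sup>2 / 2) * ennreal (N (x - y))"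
        using N0 by (simp add: distrib_right mult.assoc ennreal_leI flip: ennreal_mult ennreal_plus)
    qed
    also have "\<dots> = (\<integral>\<^sup>+x. (\<integral>\<^sup>+y. ennreal ((norm (f x))\<^sup>2 / 2) * ennreal (N (x - y)) \<partial>lborel) \<partial>lborel) +
        (\<integral>\<^sup>+x. (\<integral>\<^sup>+y. ennreal ((norm (f y))\<^sup>2 / 2) * ennreal (N (x - y)) \<partial>lborel) \<partial>lborel)"
      by (simp add: nn_integral_add)
    also have "(\<integral>\<^sup>+x. (\<integral>\<^sup>+y. ennreal ((norm (f y))\<^sup>2 / 2) * ennreal (N (x - y)) \<partial>lborel) \<partial>lborel) =
        (\<integral>\<^sup>+y. (\<integral>\<^sup>+x. ennreal ((norm (f y))\<^sup>2 / 2) * ennreal (N (x - y)) \<partial>lborel) \<partial>lborel)"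
      by (rule lborel_pair.Fubini'[symmetric]) measurable
    also have "(\<integral>\<^sup>+x. (\<integral>\<^sup>+y. ennreal ((norm (f x))\<^sup>2 / 2) * ennreal (N (x - y)) \<partial>lborel) \<partial>lborel) + \<dots> =
        (\<integral>\<^sup>+x. ennreal ((norm (f x))\<^sup>2 / 2) \<partial>lborel) + (\<integral>\<^sup>+x. ennreal ((norm (f x))\<^sup>2 / 2) \<partial>lborel)"
      by (simp add: nn_integral_cmult N1 N1')
    also have "\<dots> = ?A"
      by (subst nn_integral_add[symmetric]) (simp_all flip: ennreal_plus)
    finally show ?thesis .
  qed
  have "(\<integral>\<^sup>+\<xi>. ennreal ((norm (fourier f \<xi>))\<^sup>2) \<partial>lborel) =
      (\<integral>\<^sup>+\<xi>. liminf (\<lambda>n. ennreal ((norm (fourier f \<xi>))\<^sup>2 * w n \<xi>)) \<partial>lborel)"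
  proof (intro nn_integral_cong)
    fix \<xi>
    have "(\<lambda>n. (norm (fourier f \<xi>))\<^sup>2 * w n \<xi>) \<longlonglongrightarrow> (norm (fourier f \<xi>))\<^sup>2 * exp (- (0 * \<xi>)\<^sup>2 / 2)"
      unfolding w_def by (intro tendsto_intros LIMSEQ_inverse_real_of_nat) simp
    then have "(\<lambda>n. ennreal ((norm (fourier f \<xi>))\<^sup>2 * w n \<xi>)) \<longlonglongrightarrow> ennreal ((norm (fourier f \<xi>))\<^sup>2)"
      by (intro tendsto_ennrealI) simp
    then show "ennreal ((norm (fourier f \<xi>))\<^sup>2) = liminf (\<lambda>n. ennreal ((norm (fourier f \<xi>))\<^sup>2 * w n \<xi>))"
      by (simp add: lim_imp_Liminf)
  qed
  \<comment> \<open>Fatou's lemma.\<close>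
  also have "\<dots> \<le> liminf (\<lambda>n. \<integral>\<^sup>+\<xi>. ennreal ((norm (fourier f \<xi>))\<^sup>2 * w n \<xi>) \<partial>lborel)"
    unfolding w_def by (intro nn_integral_liminf) measurable
  also have "\<dots> \<le> ?A"
    using step by (auto intro!: Liminf_le)
  finally show ?thesis .
qed

section \<open>Hausdorff-Young inequality\<close>

text \<open>The layer-cake identity. It is used with c = s to open up |fourier f|^s, and with c = s
  - 2 to evaluate the integral over the levels at the end.\<close>

lemma nn_integral_powr_interval:
  assumes "0 < c" "0 \<le> (b::real)"
  shows "(\<integral>\<^sup>+t. (if 0 \<le> t \<and> t \<le> b then ennreal (c * t powr (c - 1)) else 0) \<partial>lborel) = ennreal (b powr c)"
proof -
  have "((\<lambda>t. c * t powr (c - 1)) has_integral c * (b powr (c - 1 + 1) / (c - 1 + 1))) {0..b}"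
    using assms by (intro has_integral_mult_right has_integral_powr_from_0) auto
  then have "((\<lambda>t. c * t powr (c - 1)) has_integral b powr c) {0..b}"
    using assms by simp
  from nn_integral_has_integral_lebesgue'[OF _ this]
  have "(\<integral>\<^sup>+t. ennreal (c * t powr (c - 1)) * indicator {0..b} t \<partial>lborel) = ennreal (b powr c)"
    using assms by simp
  moreover have "(\<lambda>t. if 0 \<le> t \<and> t \<le> b then ennreal (c * t powr (c - 1)) else 0) =
      (\<lambda>t. ennreal (c * t powr (c - 1)) * indicator {0..b} t)"
    by (auto simp: fun_eq_iff)
  ultimately show ?thesis by simp
qed

text \<open>The function is cut at the height where \<open>\<tau> \<bar>f\<bar>\<^bsup>p-1\<^esup> = 2\<close>: this is what makes the transform of the
  large part, estimated by its \<open>L\<^sup>1\<close> norm, at most \<open>\<tau>/2\<close>.\<close>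

lemma fourier_distribution_bound:
  fixes p \<tau> :: real
  assumes p: "1 < p" and f: "integrable lborel f" and l: "0 < \<tau>"
    and fp: "(\<integral>\<^sup>+x. ennreal (norm (f x) powr p) \<partial>lborel) \<le> 1"
  shows "(\<integral>\<^sup>+\<xi>. (if \<tau> \<le> norm (fourier f \<xi>) then 1 else 0) \<partial>lborel) \<le>
    (\<integral>\<^sup>+x. (if \<tau> * norm (f x) powr (p - 1) \<le> 2 then ennreal (4 / \<tau>\<^sup>2 * (norm (f x))\<^sup>2) else 0) \<partial>lborel)"
proof -
  have [measurable]: "f \<in> borel_measurable borel"
    using f by (auto dest: borel_measurable_integrable)
  define f1 where "f1 x = (if \<tau> * norm (f x) powr (p - 1) \<le> 2 then f x else 0)" for x
  define f0 where "f0 x = (if \<tau> * norm (f x) powr (p - 1) \<le> 2 then 0 else f x)" for x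
  have [measurable]: "f0 \<in> borel_measurable borel" "f1 \<in> borel_measurable borel"
    unfolding f0_def[abs_def] f1_def[abs_def] by measurable
  note [measurable] = fourier_measurable[of f1]
  have f01: "integrable lborel f0" "integrable lborel f1"
    by (rule Bochner_Integration.integrable_bound[OF f]; simp add: f0_def f1_def)+
  have split: "fourier f \<xi> = fourier f0 \<xi> + fourier f1 \<xi>" for \<xi>
    by (subst fourier_add[OF f01, symmetric], rule arg_cong[of _ _ "\<lambda>g. fourier g \<xi>"])
       (auto simp: f0_def f1_def fun_eq_iff)
  \<comment> \<open>On the large part \<tau> |f|^(p-1) exceeds 2, so multiplying by |f| bounds |f|
    by (\<tau>/2) |f|^p, whose integral is at most \<tau>/2.\<close>
  have "norm (f0 x) \<le> \<tau> / 2 * norm (f x) powr p" for x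
  proof (cases "\<tau> * norm (f x) powr (p - 1) \<le> 2 \<or> f x = 0")
    case False
    then have "norm (f x) * 2 \<le> norm (f x) * (\<tau> * norm (f x) powr (p - 1))"
      by (intro mult_left_mono) auto
    also have "\<dots> = \<tau> * norm (f x) powr p"
      using False by (simp add: powr_mult_base)
    finally show ?thesis using False by (simp add: f0_def)
  qed (use l in \<open>auto simp: f0_def\<close>)
  then have "(\<integral>\<^sup>+x. ennreal (norm (f0 x)) \<partial>lborel) \<le> (\<integral>\<^sup>+x. ennreal (\<tau> / 2) * ennreal (norm (f x) powr p) \<partial>lborel)"
    using l by (intro nn_integral_mono) (simp add: ennreal_leI flip: ennreal_mult)
  also have "\<dots> \<le> ennreal (\<tau> / 2) * 1"
    using mult_left_mono[OF fp, of "ennreal (\<tau> / 2)"] by (simp add: nn_integral_cmult)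
  finally have f0: "norm (fourier f0 \<xi>) \<le> \<tau> / 2" for \<xi>
    using ennreal_norm_fourier_le[of f0 \<xi>] l by (metis ennreal_le_iff half_gt_zero less_imp_le mult.right_neutral order_trans)
  have "(\<integral>\<^sup>+\<xi>. (if \<tau> \<le> norm (fourier f \<xi>) then 1 else 0) \<partial>lborel) \<le>
     (\<integral>\<^sup>+\<xi>. ennreal (4 / \<tau>\<^sup>2) * ennreal ((norm (fourier f1 \<xi>))\<^sup>2) \<partial>lborel)"
  proof (intro nn_integral_mono)
    fix \<xi>
    {
      assume "\<tau> \<le> norm (fourier f \<xi>)"
      \<comment> \<open>At most half of the level can come from the large part, so the small part
        has transform at least \<tau>/2; Chebyshev in L^2 then produces the constant
        4/\<tau>^2.\<close>
      with f0[of \<xi>] have "\<tau> / 2 \<le> norm (fourier f1 \<xi>)"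
        using norm_triangle_ineq[of "fourier f0 \<xi>" "fourier f1 \<xi>"] by (simp add: split)
      then have "(\<tau> / 2)\<^sup>2 \<le> (norm (fourier f1 \<xi>))\<^sup>2"
        using l by (intro power_mono) auto
      then have "1 \<le> 4 / \<tau>\<^sup>2 * (norm (fourier f1 \<xi>))\<^sup>2"
        using l by (simp add: field_simps)
      then have "1 \<le> ennreal (4 / \<tau>\<^sup>2 * (norm (fourier f1 \<xi>))\<^sup>2)"
        by (metis ennreal_1 ennreal_leI)
    }
    then show "(if \<tau> \<le> norm (fourier f \<xi>) then 1 else 0) \<le> ennreal (4 / \<tau>\<^sup>2) * ennreal ((norm (fourier f1 \<xi>))\<^sup>2)"
      by (auto simp flip: ennreal_mult)
  qed
  also have "\<dots> = ennreal (4 / \<tau>\<^sup>2) * (\<integral>\<^sup>+\<xi>. ennreal ((norm (fourier f1 \<xi>))\<^sup>2) \<partial>lborel)"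
    by (rule nn_integral_cmult) measurable
  also have "\<dots> \<le> ennreal (4 / \<tau>\<^sup>2) * (\<integral>\<^sup>+x. ennreal ((norm (f1 x))\<^sup>2) \<partial>lborel)"
    by (intro mult_left_mono plancherel_le f01) auto
  also have "\<dots> = (\<integral>\<^sup>+x. ennreal (4 / \<tau>\<^sup>2) * ennreal ((norm (f1 x))\<^sup>2) \<partial>lborel)"
    by (rule nn_integral_cmult[symmetric]) measurable
  also have "\<dots> = (\<integral>\<^sup>+x. (if \<tau> * norm (f x) powr (p - 1) \<le> 2 then ennreal (4 / \<tau>\<^sup>2 * (norm (f x))\<^sup>2) else 0) \<partial>lborel)"
    by (intro nn_integral_cong) (auto simp: f1_def simp flip: ennreal_mult)
  finally show ?thesis .
qed

text \<open>The distribution bound is inserted into the layer-cake formula and the integrals are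
  swapped. For fixed x the levels run up to 2 |f|^(1-p), and integrating 4 s \<tau>^(s-3) |f|^2 up
  to there gives the stated constant times |f|^p.\<close>

lemma hausdorff_young_interior:
  fixes p s :: real
  assumes p: "1 < p" "p < 2" and s: "s = p / (p - 1)" and f: "integrable lborel f"
    and fp: "(\<integral>\<^sup>+x. ennreal (norm (f x) powr p) \<partial>lborel) \<le> 1"
  shows "(\<integral>\<^sup>+\<xi>. ennreal (norm (fourier f \<xi>) powr s) \<partial>lborel) \<le> ennreal (4 * s / (s - 2) * 2 powr (s - 2))"
    (is "_ \<le> ennreal ?C")
proof -
  have s2: "s > 2" using p by (simp add: s field_simps)
  \<comment> \<open>The exponent balance that makes the final power of |f| exactly p.\<close>
  have ps: "(p - 1) * (s - 2) = 2 - p" using p by (simp add: s field_simps)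
  have [measurable]: "f \<in> borel_measurable borel"
    using f by (auto dest: borel_measurable_integrable)
  note [measurable] = fourier_measurable[of f]
  have "(\<integral>\<^sup>+\<xi>. ennreal (norm (fourier f \<xi>) powr s) \<partial>lborel) =
     (\<integral>\<^sup>+\<xi>. (\<integral>\<^sup>+\<tau>. (if 0 \<le> \<tau> \<and> \<tau> \<le> norm (fourier f \<xi>) then ennreal (s * \<tau> powr (s - 1)) else 0) \<partial>lborel) \<partial>lborel)"
    using s2 by (intro nn_integral_cong nn_integral_powr_interval[symmetric]) auto
  also have "\<dots> = (\<integral>\<^sup>+\<tau>. (\<integral>\<^sup>+\<xi>. (if 0 \<le> \<tau> \<and> \<tau> \<le> norm (fourier f \<xi>) then ennreal (s * \<tau> powr (s - 1)) else 0) \<partial>lborel) \<partial>lborel)"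
    by (rule lborel_pair.Fubini'[symmetric]) measurable
  also have "\<dots> \<le> (\<integral>\<^sup>+\<tau>. (\<integral>\<^sup>+x. (if 0 \<le> \<tau> \<and> \<tau> * norm (f x) powr (p - 1) \<le> 2
      then ennreal (4 * s / (s - 2) * (norm (f x))\<^sup>2 * ((s - 2) * \<tau> powr (s - 2 - 1))) else 0) \<partial>lborel) \<partial>lborel)"
    (is "_ \<le> (\<integral>\<^sup>+\<tau>. ?R \<tau> \<partial>lborel)")
  proof (rule nn_integral_mono)
    fix \<tau> :: real
    \<comment> \<open>At \<tau> = 0 the factor \<open>\<tau> powr (s - 1)\<close> is 0, so the
      distribution bound is called for positive levels only.\<close>
    consider "\<tau> < 0" | "\<tau> = 0" | "\<tau> > 0" by linarith
    then show "(\<integral>\<^sup>+\<xi>. (if 0 \<le> \<tau> \<and> \<tau> \<le> norm (fourier f \<xi>) then ennreal (s * \<tau> powr (s - 1)) else 0) \<partial>lborel) \<le> ?R \<tau>"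
    proof cases
      case 3
      have "(\<integral>\<^sup>+\<xi>. (if 0 \<le> \<tau> \<and> \<tau> \<le> norm (fourier f \<xi>) then ennreal (s * \<tau> powr (s - 1)) else 0) \<partial>lborel) =
         (\<integral>\<^sup>+\<xi>. ennreal (s * \<tau> powr (s - 1)) * (if \<tau> \<le> norm (fourier f \<xi>) then 1 else 0) \<partial>lborel)"
        using 3 by (intro nn_integral_cong) auto
      also have "\<dots> = ennreal (s * \<tau> powr (s - 1)) * (\<integral>\<^sup>+\<xi>. (if \<tau> \<le> norm (fourier f \<xi>) then 1 else 0) \<partial>lborel)"
        by (rule nn_integral_cmult) measurable
      also have "\<dots> \<le> ennreal (s * \<tau> powr (s - 1)) *
        (\<integral>\<^sup>+x. (if \<tau> * norm (f x) powr (p - 1) \<le> 2 then ennreal (4 / \<tau>\<^sup>2 * (norm (f x))\<^sup>2) else 0) \<partial>lborel)"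
        by (intro mult_left_mono fourier_distribution_bound p f fp 3) simp
      also have "\<dots> = (\<integral>\<^sup>+x. ennreal (s * \<tau> powr (s - 1)) *
         (if \<tau> * norm (f x) powr (p - 1) \<le> 2 then ennreal (4 / \<tau>\<^sup>2 * (norm (f x))\<^sup>2) else 0) \<partial>lborel)"
        by (rule nn_integral_cmult[symmetric]) measurable
      also have "\<dots> = ?R \<tau>"
      proof (intro nn_integral_cong)
        fix x
        \<comment> \<open>The division by \<tau>^2 lowers the power to s - 3; the factor s - 2 is
          inserted to match \<open>nn_integral_powr_interval\<close> with c = s - 2.\<close>
        have "\<tau> powr (s - 1) = \<tau> powr (s - 2 - 1) * \<tau>\<^sup>2"
          using 3 by (simp add: powr_add[symmetric] flip: powr_numeral)
        then have "s * \<tau> powr (s - 1) * (4 / \<tau>\<^sup>2 * (norm (f x))\<^sup>2) =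
            4 * s / (s - 2) * (norm (f x))\<^sup>2 * ((s - 2) * \<tau> powr (s - 2 - 1))"
          using 3 s2 by (simp add: field_simps)
        then show "ennreal (s * \<tau> powr (s - 1)) *
         (if \<tau> * norm (f x) powr (p - 1) \<le> 2 then ennreal (4 / \<tau>\<^sup>2 * (norm (f x))\<^sup>2) else 0) =
         (if 0 \<le> \<tau> \<and> \<tau> * norm (f x) powr (p - 1) \<le> 2
          then ennreal (4 * s / (s - 2) * (norm (f x))\<^sup>2 * ((s - 2) * \<tau> powr (s - 2 - 1))) else 0)"
          using 3 s2 by (simp flip: ennreal_mult)
      qed
      finally show ?thesis .
    qed auto
  qed
  also have "\<dots> = (\<integral>\<^sup>+x. (\<integral>\<^sup>+\<tau>. (if 0 \<le> \<tau> \<and> \<tau> * norm (f x) powr (p - 1) \<le> 2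
      then ennreal (4 * s / (s - 2) * (norm (f x))\<^sup>2 * ((s - 2) * \<tau> powr (s - 2 - 1))) else 0) \<partial>lborel) \<partial>lborel)"
    by (rule lborel_pair.Fubini') measurable
  also have "\<dots> = (\<integral>\<^sup>+x. ennreal ?C * ennreal (norm (f x) powr p) \<partial>lborel)"
  proof (intro nn_integral_cong)
    fix x
    show "(\<integral>\<^sup>+\<tau>. (if 0 \<le> \<tau> \<and> \<tau> * norm (f x) powr (p - 1) \<le> 2
      then ennreal (4 * s / (s - 2) * (norm (f x))\<^sup>2 * ((s - 2) * \<tau> powr (s - 2 - 1))) else 0) \<partial>lborel) =
      ennreal ?C * ennreal (norm (f x) powr p)"
    proof (cases "f x = 0")
      case True
      then show ?thesis by (simp cong: if_cong)
    next
      case False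
      \<comment> \<open>The largest admissible level: \<tau> |f|^(p-1) \<le> 2 is equivalent to
        \<tau> \<le> b.\<close>
      define b where "b = 2 * norm (f x) powr (1 - p)"
      have pos: "norm (f x) powr (p - 1) > 0" using False by simp
      have b: "b = 2 / norm (f x) powr (p - 1)"
        using powr_minus_divide[of "norm (f x)" "p - 1"] by (simp add: b_def)
      have "(\<integral>\<^sup>+\<tau>. (if 0 \<le> \<tau> \<and> \<tau> * norm (f x) powr (p - 1) \<le> 2
          then ennreal (4 * s / (s - 2) * (norm (f x))\<^sup>2 * ((s - 2) * \<tau> powr (s - 2 - 1))) else 0) \<partial>lborel) =
        (\<integral>\<^sup>+\<tau>. ennreal (4 * s / (s - 2) * (norm (f x))\<^sup>2) *
          (if 0 \<le> \<tau> \<and> \<tau> \<le> b then ennreal ((s - 2) * \<tau> powr (s - 2 - 1)) else 0) \<partial>lborel)"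
        using pos s2 by (intro nn_integral_cong) (auto simp: b pos_le_divide_eq simp flip: ennreal_mult)
      also have "\<dots> = ennreal (4 * s / (s - 2) * (norm (f x))\<^sup>2) * ennreal (b powr (s - 2))"
        using s2 by (subst nn_integral_cmult, measurable) (simp add: nn_integral_powr_interval b_def)
      also have "\<dots> = ennreal (4 * s / (s - 2) * (norm (f x))\<^sup>2 * b powr (s - 2))"
        using s2 by (simp flip: ennreal_mult)
      also have "4 * s / (s - 2) * (norm (f x))\<^sup>2 * b powr (s - 2) = ?C * norm (f x) powr p"
      proof -
        have "(1 - p) * (s - 2) = p - 2" using ps by (simp add: algebra_simps)
        then have "b powr (s - 2) = 2 powr (s - 2) * norm (f x) powr (p - 2)"
          by (simp add: b_def powr_mult powr_powr)
        then have "4 * s / (s - 2) * (norm (f x))\<^sup>2 * b powr (s - 2) =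
            ?C * ((norm (f x))\<^sup>2 * norm (f x) powr (p - 2))"
          by (simp only: times_divide_eq_left mult_ac)
        also have "(norm (f x))\<^sup>2 * norm (f x) powr (p - 2) = norm (f x) powr p"
          using False by (simp add: powr_diff)
        finally show ?thesis .
      qed
      also have "ennreal (?C * norm (f x) powr p) = ennreal ?C * ennreal (norm (f x) powr p)"
        using s2 by (intro ennreal_mult) auto
      finally show ?thesis .
    qed
  qed
  also have "\<dots> = ennreal ?C * (\<integral>\<^sup>+x. ennreal (norm (f x) powr p) \<partial>lborel)"
    by (rule nn_integral_cmult) measurable
  also have "\<dots> \<le> ennreal ?C * 1"
    by (intro mult_left_mono fp) simp
  finally show ?thesis by simp
qed

text \<open>The interior constant has s - 2 in its denominator and degenerates as p tends to 2, so
  the endpoint p = 2 is taken from Plancherel.\<close>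

lemma hausdorff_young:
  fixes p :: real
  assumes p: "1 < p" "p \<le> 2"
  obtains C where "C > 0" "\<And>f. integrable lborel f \<Longrightarrow> (\<integral>\<^sup>+x. ennreal (norm (f x) powr p) \<partial>lborel) \<le> 1 \<Longrightarrow>
    (\<integral>\<^sup>+\<xi>. ennreal (norm (fourier f \<xi>) powr (p / (p - 1))) \<partial>lborel) \<le> ennreal C"
proof (cases "p = 2")
  case True
  have "(\<integral>\<^sup>+\<xi>. ennreal (norm (fourier f \<xi>) powr (p / (p - 1))) \<partial>lborel) \<le> ennreal 1"
    if "integrable lborel f" "(\<integral>\<^sup>+x. ennreal (norm (f x) powr p) \<partial>lborel) \<le> 1" for f
    using plancherel_le[OF that(1)] that(2) True by simp
  then show ?thesis using that[of 1] by simp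
next
  case False
  define s where "s = p / (p - 1)"
  have "s > 2" using p False by (simp add: s_def field_simps)
  then have "4 * s / (s - 2) * 2 powr (s - 2) > 0" by simp
  from that[OF this] show ?thesis
    using hausdorff_young_interior[OF _ _ s_def] p False by (simp add: s_def)
qed

text \<open>The normalised ingredient of a majorant: \<open>norm F \<le> N * h powr (1 / s)\<close>
  with such an h implies that the L^s norm of F is at most N. Products of majorants can then be
  estimated by weighted means of their densities.\<close>

definition unit_mass :: "(real \<Rightarrow> real) \<Rightarrow> bool" where
  "unit_mass h \<longleftrightarrow> h \<in> borel_measurable borel \<and> (\<forall>x. 0 \<le> h x) \<and> (\<integral>\<^sup>+x. ennreal (h x) \<partial>lborel) \<le> 1"

lemma unit_massI:
  "h \<in> borel_measurable borel \<Longrightarrow> (\<And>x. 0 \<le> h x) \<Longrightarrow> (\<integral>\<^sup>+x. ennreal (h x) \<partial>lborel) \<le> 1 \<Longrightarrow> unit_mass h"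
  by (simp add: unit_mass_def)

lemma unit_massD:
  assumes "unit_mass h"
  shows "h \<in> borel_measurable borel" "\<And>x. 0 \<le> h x" "(\<integral>\<^sup>+x. ennreal (h x) \<partial>lborel) \<le> 1"
  using assms by (auto simp: unit_mass_def)

text \<open>The case \<open>p = 1\<close> is included by taking for \<open>h\<close> any positive probability density.\<close>

lemma hausdorff_young_majorant:
  fixes p :: real
  assumes p: "1 \<le> p" "p \<le> 2"
  obtains C where "C > 0" "\<And>f. integrable lborel f \<Longrightarrow> (\<integral>\<^sup>+x. ennreal (norm (f x) powr p) \<partial>lborel) \<le> 1 \<Longrightarrow>
    \<exists>h. unit_mass h \<and>
      (\<forall>\<xi>. norm (fourier f \<xi>) \<le> C * h \<xi> powr (1 - 1 / p))"
proof (cases "p = 1")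
  case True
  have "\<exists>h. unit_mass h \<and>
      (\<forall>\<xi>. norm (fourier f \<xi>) \<le> 1 * h \<xi> powr (1 - 1 / p))"
    if f: "integrable lborel f" "(\<integral>\<^sup>+x. ennreal (norm (f x) powr p) \<partial>lborel) \<le> 1" for f
  \<comment> \<open>Strict positivity matters: the exponent is 0 here and \<open>0 powr 0\<close> is
    0, so a density with zeros would force the transform to vanish there.\<close>
  proof (intro exI[of _ std_normal_density] conjI allI unit_massI)
    have "norm (fourier f \<xi>) \<le> 1" for \<xi>
    proof -
      note ennreal_norm_fourier_le[of f \<xi>]
      also have "(\<integral>\<^sup>+x. ennreal (norm (f x)) \<partial>lborel) \<le> ennreal 1"
        using f(2) True by simp
      finally show ?thesis by simp
    qed
    moreover have "std_normal_density \<xi> \<noteq> 0" for \<xi>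
      using normal_density_pos[of 1 0 \<xi>] by simp
    ultimately show "norm (fourier f \<xi>) \<le> 1 * std_normal_density \<xi> powr (1 - 1 / p)" for \<xi>
      using True by simp
    show "(\<integral>\<^sup>+x. ennreal (std_normal_density x) \<partial>lborel) \<le> 1"
      by (subst nn_integral_eq_integral) auto
  qed auto
  then show ?thesis using that[of 1] by simp
next
  case False
  then have p1: "1 < p" using p by simp
  define s where "s = p / (p - 1)"
  have s: "s > 0" "1 - 1 / p = 1 / s" using p1 by (auto simp: s_def field_simps)
  obtain C where C: "C > 0" "\<And>f. integrable lborel f \<Longrightarrow> (\<integral>\<^sup>+x. ennreal (norm (f x) powr p) \<partial>lborel) \<le> 1 \<Longrightarrow>
    (\<integral>\<^sup>+\<xi>. ennreal (norm (fourier f \<xi>) powr s) \<partial>lborel) \<le> ennreal C"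
    using hausdorff_young[OF p1 p(2)] unfolding s_def by metis
  have "\<exists>h. unit_mass h \<and>
      (\<forall>\<xi>. norm (fourier f \<xi>) \<le> C powr (1 / s) * h \<xi> powr (1 - 1 / p))"
    if f: "integrable lborel f" "(\<integral>\<^sup>+x. ennreal (norm (f x) powr p) \<partial>lborel) \<le> 1" for f
  \<comment> \<open>The density is |fourier f|^s divided by C; its 1/s-th power, times C^(1/s),
    gives back |fourier f| exactly.\<close>
  proof (intro exI[of _ "\<lambda>\<xi>. 1 / C * norm (fourier f \<xi>) powr s"] conjI allI unit_massI)
    have [measurable]: "f \<in> borel_measurable borel"
      using f by (auto dest: borel_measurable_integrable)
    note [measurable] = fourier_measurable[of f]
    show "(\<lambda>\<xi>. 1 / C * norm (fourier f \<xi>) powr s) \<in> borel_measurable borel" by measurable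
    show "0 \<le> 1 / C * norm (fourier f \<xi>) powr s" for \<xi> using C(1) by simp
    show "norm (fourier f \<xi>) \<le> C powr (1 / s) * (1 / C * norm (fourier f \<xi>) powr s) powr (1 - 1 / p)" for \<xi>
      using C(1) s by (simp add: s(2) powr_mult[symmetric] powr_powr flip: powr_divide)
    have "(\<integral>\<^sup>+\<xi>. ennreal (1 / C * norm (fourier f \<xi>) powr s) \<partial>lborel) =
        ennreal (1 / C) * (\<integral>\<^sup>+\<xi>. ennreal (norm (fourier f \<xi>) powr s) \<partial>lborel)"
      using C(1) by (subst nn_integral_cmult[symmetric]) (simp_all flip: ennreal_mult)
    also have "\<dots> \<le> ennreal (1 / C) * ennreal C"
      by (intro mult_left_mono C f) simp
    also have "\<dots> = 1" using C(1) by (simp flip: ennreal_mult)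
    finally show "(\<integral>\<^sup>+\<xi>. ennreal (1 / C * norm (fourier f \<xi>) powr s) \<partial>lborel) \<le> 1" .
  qed
  then show ?thesis using that[of "C powr (1 / s)"] C(1) by simp
qed

section \<open>Convolution estimate\<close>

text \<open>Let exp L be the geometric mean on the left. The tangent inequality exp x \<ge> 1 + x at
  x = ln t - L, averaged over the four entries, loses its logarithms because the weighted mean of
  the ln t is L.\<close>

lemma weighted_am_gm_4:
  fixes a b c d :: real
  assumes nn: "0 \<le> a" "0 \<le> b" "0 \<le> c" "0 \<le> d"
    and k: "0 \<le> i" "0 \<le> j" "0 \<le> k" "0 \<le> l" "i + j + k + l = 1"
  shows "a powr i * b powr j * c powr k * d powr l \<le> i * a + j * b + k * c + l * d"
\<comment> \<open>Since \<open>0 powr x\<close> is 0 even for x = 0, a vanishing entry annihilates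
  the left side whatever its weight.\<close>
proof (cases "a = 0 \<or> b = 0 \<or> c = 0 \<or> d = 0")
  case True
  then show ?thesis using nn k by auto
next
  case False
  with nn have pos: "0 < a" "0 < b" "0 < c" "0 < d" by auto
  define L where "L = i * ln a + j * ln b + k * ln c + l * ln d"
  have tangent: "1 + ln t - L \<le> t * exp (- L)" if "0 < t" for t
    using exp_ge_add_one_self[of "ln t - L"] that by (simp add: exp_diff exp_minus divide_inverse)
  have "(i + j + k + l) * (1 - L) + L = i * (1 + ln a - L) + j * (1 + ln b - L) + k * (1 + ln c - L) + l * (1 + ln d - L)"
    by (simp add: L_def algebra_simps)
  also have "\<dots> \<le> i * (a * exp (- L)) + j * (b * exp (- L)) + k * (c * exp (- L)) + l * (d * exp (- L))"
    using k pos by (intro add_mono mult_left_mono tangent) auto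
  also have "\<dots> = (i * a + j * b + k * c + l * d) * exp (- L)"
    by (simp add: algebra_simps)
  finally have "1 \<le> (i * a + j * b + k * c + l * d) * exp (- L)"
    using k by simp
  then have "exp L \<le> i * a + j * b + k * c + l * d"
    by (simp add: exp_minus field_simps)
  then show ?thesis
    using pos by (simp add: powr_def L_def exp_add)
qed

lemma nn_integral_add_le_real:
  fixes u v :: "'a \<Rightarrow> real" and A B i j :: real
  assumes [measurable]: "u \<in> borel_measurable M" "v \<in> borel_measurable M"
    and "\<And>x. 0 \<le> u x" "\<And>x. 0 \<le> v x" "0 \<le> i" "0 \<le> j" "0 \<le> A" "0 \<le> B"
    and "(\<integral>\<^sup>+x. ennreal (u x) \<partial>M) \<le> ennreal A" "(\<integral>\<^sup>+x. ennreal (v x) \<partial>M) \<le> ennreal B"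
  shows "(\<integral>\<^sup>+x. ennreal (i * u x + j * v x) \<partial>M) \<le> ennreal (i * A + j * B)"
proof -
  have "(\<integral>\<^sup>+x. ennreal (i * u x + j * v x) \<partial>M) =
      ennreal i * (\<integral>\<^sup>+x. ennreal (u x) \<partial>M) + ennreal j * (\<integral>\<^sup>+x. ennreal (v x) \<partial>M)"
    using assms by (simp add: ennreal_mult nn_integral_add nn_integral_cmult)
  also have "\<dots> \<le> ennreal i * ennreal A + ennreal j * ennreal B"
    using assms by (intro add_mono mult_left_mono) auto
  also have "\<dots> = ennreal (i * A + j * B)"
    using assms by (simp add: ennreal_mult)
  finally show ?thesis .
qed

text \<open>The pointwise form of Young's convolution inequality: the factor \<open>(u v)\<^sup>\<rho>\<close> is split off before
  Hoelder's inequality is applied, so that the bound keeps the integral of \<open>u v\<close>.\<close>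

lemma holder_refined:
  fixes u v w :: "'a \<Rightarrow> real" and \<alpha> \<beta> \<pi> \<rho> H W :: real
  assumes [measurable]: "u \<in> borel_measurable M" "v \<in> borel_measurable M" "w \<in> borel_measurable M"
    and nn: "\<And>x. 0 \<le> u x" "\<And>x. 0 \<le> v x" "\<And>x. 0 \<le> w x"
    and exps: "0 \<le> \<rho>" "\<rho> \<le> \<alpha>" "\<rho> \<le> \<beta>" "0 \<le> \<pi>" "\<alpha> + \<beta> + \<pi> = 1 + \<rho>"
    and u: "(\<integral>\<^sup>+x. ennreal (u x) \<partial>M) \<le> 1" and v: "(\<integral>\<^sup>+x. ennreal (v x) \<partial>M) \<le> 1"
    and H: "(\<integral>\<^sup>+x. ennreal (u x * v x) \<partial>M) = ennreal H" "0 \<le> H"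
    and W: "(\<integral>\<^sup>+x. ennreal (w x) \<partial>M) = ennreal W" "0 \<le> W"
  shows "(\<integral>\<^sup>+x. ennreal (u x powr \<alpha> * v x powr \<beta> * w x powr \<pi>) \<partial>M) \<le> ennreal (H powr \<rho> * W powr \<pi>)"
\<comment> \<open>The main argument divides by H and W. If one of them is 0, the integrand vanishes
  almost everywhere.\<close>
proof (cases "H = 0 \<or> W = 0")
  case True
  have "AE x in M. u x powr \<alpha> * v x powr \<beta> * w x powr \<pi> = 0"
  proof (cases "H = 0")
    case True
    then have "AE x in M. ennreal (u x * v x) = 0"
      using H by (subst nn_integral_0_iff_AE[symmetric]) auto
    then show ?thesis
    proof eventually_elim
      case (elim x)
      then have "u x * v x = 0"
        by (intro antisym) (simp_all only: ennreal_eq_0_iff mult_nonneg_nonneg nn)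
      then show ?case by auto
    qed
  next
    case False
    then have "AE x in M. ennreal (w x) = 0"
      using W True by (subst nn_integral_0_iff_AE[symmetric]) auto
    then show ?thesis
      by eventually_elim (use nn in \<open>auto simp: ennreal_eq_0_iff intro: antisym\<close>)
  qed
  then have "AE x in M. ennreal (u x powr \<alpha> * v x powr \<beta> * w x powr \<pi>) = 0"
    by eventually_elim simp
  then have "(\<integral>\<^sup>+x. ennreal (u x powr \<alpha> * v x powr \<beta> * w x powr \<pi>) \<partial>M) = 0"
    by (subst nn_integral_0_iff_AE) auto
  then show ?thesis by simp
next
  case False
  with H W have pos: "H > 0" "W > 0" by auto
  let ?K = "H powr \<rho> * W powr \<pi>"
  \<comment> \<open>Weighted means of u v / H, w / W, u and v with weights \<rho>, \<pi>, \<alpha> -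
    \<rho>, \<beta> - \<rho>, which sum to 1; each of the four functions has integral at most 1. The
    factors \<open>1 *\<close> only fit the shape of \<open>nn_integral_add_le_real\<close>.\<close>
  have pw: "u x powr \<alpha> * v x powr \<beta> * w x powr \<pi> \<le>
      ?K * (1 * (\<rho> / H * (u x * v x) + \<pi> / W * w x) + 1 * ((\<alpha> - \<rho>) * u x + (\<beta> - \<rho>) * v x))" for x
  proof (cases "u x = 0 \<or> v x = 0 \<or> w x = 0")
    case True
    then show ?thesis using nn[of x] exps pos by auto
  next
    case False
    with nn[of x] have p: "u x > 0" "v x > 0" "w x > 0" by (auto simp: less_le)
    have "u x powr \<alpha> * v x powr \<beta> * w x powr \<pi> =
        ?K * (((u x * v x) / H) powr \<rho> * (w x / W) powr \<pi> * u x powr (\<alpha> - \<rho>) * v x powr (\<beta> - \<rho>))"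
      using p pos by (simp add: powr_divide powr_mult powr_diff field_simps)
    also have "\<dots> \<le> ?K * (\<rho> * ((u x * v x) / H) + \<pi> * (w x / W) + (\<alpha> - \<rho>) * u x + (\<beta> - \<rho>) * v x)"
      using p pos exps by (intro mult_left_mono weighted_am_gm_4) auto
    finally show ?thesis by (simp add: algebra_simps)
  qed
  have 1: "(\<integral>\<^sup>+x. ennreal (\<rho> / H * (u x * v x) + \<pi> / W * w x) \<partial>M) \<le> ennreal (\<rho> / H * H + \<pi> / W * W)"
    using nn exps pos H(1) W(1) by (intro nn_integral_add_le_real) auto
  have 2: "(\<integral>\<^sup>+x. ennreal ((\<alpha> - \<rho>) * u x + (\<beta> - \<rho>) * v x) \<partial>M) \<le> ennreal ((\<alpha> - \<rho>) * 1 + (\<beta> - \<rho>) * 1)"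
    using nn exps u v by (intro nn_integral_add_le_real) auto
  have "(\<integral>\<^sup>+x. ennreal (u x powr \<alpha> * v x powr \<beta> * w x powr \<pi>) \<partial>M) \<le>
      (\<integral>\<^sup>+x. ennreal ?K * ennreal (1 * (\<rho> / H * (u x * v x) + \<pi> / W * w x) + 1 * ((\<alpha> - \<rho>) * u x + (\<beta> - \<rho>) * v x)) \<partial>M)"
    by (subst ennreal_mult'[symmetric], simp) (intro nn_integral_mono ennreal_leI pw)
  also have "\<dots> = ennreal ?K * (\<integral>\<^sup>+x. ennreal (1 * (\<rho> / H * (u x * v x) + \<pi> / W * w x) + 1 * ((\<alpha> - \<rho>) * u x + (\<beta> - \<rho>) * v x)) \<partial>M)"
    by (rule nn_integral_cmult) measurable
  also have "\<dots> \<le> ennreal ?K * ennreal (1 * (\<rho> / H * H + \<pi> / W * W) + 1 * ((\<alpha> - \<rho>) * 1 + (\<beta> - \<rho>) * 1))"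
    by (intro mult_left_mono nn_integral_add_le_real 1 2) (use nn exps pos in auto)
  also have "1 * (\<rho> / H * H + \<pi> / W * W) + 1 * ((\<alpha> - \<rho>) * 1 + (\<beta> - \<rho>) * 1) = 1"
    using pos exps by simp
  finally show ?thesis by simp
qed

section \<open>Integration along the lines \<xi> + \<eta> = t\<close>

lemma nn_integral_shear:
  fixes h :: "real \<times> real \<Rightarrow> ennreal"
  assumes h: "h \<in> borel_measurable borel"
  shows "(\<integral>\<^sup>+t. (\<integral>\<^sup>+\<xi>. h (\<xi>, t - \<xi>) \<partial>lborel) \<partial>lborel) = (\<integral>\<^sup>+z. h z \<partial>lborel)"
proof -
  have [measurable]: "h \<in> borel_measurable (borel \<Otimes>\<^sub>M borel)" using h by (simp add: borel_prod)
  have "(\<integral>\<^sup>+t. (\<integral>\<^sup>+\<xi>. h (\<xi>, t - \<xi>) \<partial>lborel) \<partial>lborel) = (\<integral>\<^sup>+\<xi>. (\<integral>\<^sup>+t. h (\<xi>, t - \<xi>) \<partial>lborel) \<partial>lborel)"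
    by (rule lborel_pair.Fubini') measurable
  also have "\<dots> = (\<integral>\<^sup>+\<xi>. (\<integral>\<^sup>+\<eta>. h (\<xi>, \<eta>) \<partial>lborel) \<partial>lborel)"
  proof (rule nn_integral_cong)
    fix \<xi> :: real
    show "(\<integral>\<^sup>+t. h (\<xi>, t - \<xi>) \<partial>lborel) = (\<integral>\<^sup>+\<eta>. h (\<xi>, \<eta>) \<partial>lborel)"
      using nn_integral_real_affine[of "\<lambda>\<eta>. h (\<xi>, \<eta>)" 1 "- \<xi>"] by simp
  qed
  also have "\<dots> = (\<integral>\<^sup>+z. h z \<partial>(lborel \<Otimes>\<^sub>M lborel))"
    by (rule lborel.nn_integral_fst) measurable
  finally show ?thesis by (simp add: lborel_prod)
qed

text \<open>On the line \<xi> + \<eta> = t, \<open>holder_refined\<close> gives the bound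
  H(t)^\<rho> W(t)^\<pi>, where H is the convolution of x and y and W(t) is the mass of w on that
  line. Both have integral at most 1 over t, so a convex combination of them serves as G.\<close>

lemma convolution_majorant:
  fixes x y :: "real \<Rightarrow> real" and w :: "real \<times> real \<Rightarrow> real" and \<alpha> \<beta> \<pi> \<rho> :: real
  assumes x: "unit_mass x" and y: "unit_mass y"
    and w: "w \<in> borel_measurable borel" and w0: "\<And>z. 0 \<le> w z"
    and w1: "(\<integral>\<^sup>+z. ennreal (w z) \<partial>lborel) \<le> 1"
    and exps: "0 \<le> \<rho>" "\<rho> \<le> \<alpha>" "\<rho> \<le> \<beta>" "0 < \<pi>" "\<alpha> + \<beta> + \<pi> = 1 + \<rho>"
  obtains G where "unit_mass G"
    "AE t in lborel. (\<integral>\<^sup>+\<xi>. ennreal (x \<xi> powr \<alpha> * y (t - \<xi>) powr \<beta> * w (\<xi>, t - \<xi>) powr \<pi>) \<partial>lborel)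
      \<le> ennreal (G t powr (\<rho> + \<pi>))"
proof -
  note [measurable] = unit_massD(1)[OF x] unit_massD(1)[OF y]
  note x1 = unit_massD(3)[OF x] and y1 = unit_massD(3)[OF y]
  note nn = unit_massD(2)[OF x] unit_massD(2)[OF y] w0
  have wm [measurable]: "w \<in> borel_measurable (borel \<Otimes>\<^sub>M borel)" using w by (simp add: borel_prod)
  define H where "H t = (\<integral>\<^sup>+\<xi>. ennreal (x \<xi> * y (t - \<xi>)) \<partial>lborel)" for t
  define W where "W t = (\<integral>\<^sup>+\<xi>. ennreal (w (\<xi>, t - \<xi>)) \<partial>lborel)" for t
  have [measurable]: "H \<in> borel_measurable borel" "W \<in> borel_measurable borel"
    unfolding H_def[abs_def] W_def[abs_def] by measurable
  have y_shift: "(\<integral>\<^sup>+\<xi>. ennreal (y (t - \<xi>)) \<partial>lborel) \<le> 1" for t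
    using nn_integral_real_affine[of "\<lambda>\<xi>. ennreal (y \<xi>)" "-1" t] y1 by simp
  have "(\<integral>\<^sup>+t. H t \<partial>lborel) = (\<integral>\<^sup>+z. ennreal (x (fst z) * y (snd z)) \<partial>lborel)"
    using nn_integral_shear[of "\<lambda>z. ennreal (x (fst z) * y (snd z))"] by (simp add: H_def flip: borel_prod)
  also have "\<dots> = (\<integral>\<^sup>+\<xi>. (\<integral>\<^sup>+\<eta>. ennreal (x \<xi>) * ennreal (y \<eta>) \<partial>lborel) \<partial>lborel)"
    using nn by (simp flip: lborel_prod lborel.nn_integral_fst add: ennreal_mult)
  also have "\<dots> = (\<integral>\<^sup>+\<xi>. ennreal (x \<xi>) \<partial>lborel) * (\<integral>\<^sup>+\<eta>. ennreal (y \<eta>) \<partial>lborel)"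
    by (simp add: nn_integral_cmult nn_integral_multc)
  also have "\<dots> \<le> 1 * 1"
    by (intro mult_mono x1 y1) auto
  finally have H1: "(\<integral>\<^sup>+t. H t \<partial>lborel) \<le> 1" by simp
  have W1: "(\<integral>\<^sup>+t. W t \<partial>lborel) \<le> 1"
    using nn_integral_shear[of "\<lambda>z. ennreal (w z)"] w w1 by (simp add: W_def)
  \<comment> \<open>H and W may be infinite on a null set, which is why the conclusion is only
    almost everywhere and \<open>enn2real\<close> does no harm.\<close>
  have finH: "AE t in lborel. H t \<noteq> \<infinity>" and finW: "AE t in lborel. W t \<noteq> \<infinity>"
    using H1 W1 by (intro nn_integral_PInf_AE; force simp: top_unique)+
  have H1': "(\<integral>\<^sup>+t. ennreal (enn2real (H t)) \<partial>lborel) \<le> ennreal 1"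
    by (rule order_trans[OF nn_integral_mono[where v = H]]) (use H1 in \<open>auto simp: ennreal_enn2real_if\<close>)
  have W1': "(\<integral>\<^sup>+t. ennreal (enn2real (W t)) \<partial>lborel) \<le> ennreal 1"
    by (rule order_trans[OF nn_integral_mono[where v = W]]) (use W1 in \<open>auto simp: ennreal_enn2real_if\<close>)
  \<comment> \<open>Normalises the weights \<rho> and \<pi> to sum 1; \<pi> > 0 keeps the
    denominator positive.\<close>
  define q where "q = 1 / (\<rho> + \<pi>)"
  have q: "q > 0" "q * \<rho> + q * \<pi> = 1"
    using exps by (auto simp: q_def simp flip: add_divide_distrib)
  define G where "G t = q * \<rho> * enn2real (H t) + q * \<pi> * enn2real (W t)" for t
  show thesis
  proof (rule that[of G])
    show "unit_mass G"
    proof (rule unit_massI)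
      show "G \<in> borel_measurable borel" unfolding G_def by measurable
      show "0 \<le> G t" for t unfolding G_def using q exps by auto
      show "(\<integral>\<^sup>+t. ennreal (G t) \<partial>lborel) \<le> 1"
        unfolding G_def using nn_integral_add_le_real[of "\<lambda>t. enn2real (H t)" lborel "\<lambda>t. enn2real (W t)" "q * \<rho>" "q * \<pi>" 1 1]
          H1' W1' q exps by simp
    qed
    show "AE t in lborel. (\<integral>\<^sup>+\<xi>. ennreal (x \<xi> powr \<alpha> * y (t - \<xi>) powr \<beta> * w (\<xi>, t - \<xi>) powr \<pi>) \<partial>lborel)
      \<le> ennreal (G t powr (\<rho> + \<pi>))"
      using finH finW
    proof eventually_elim
      case (elim t)
      let ?h = "enn2real (H t)" and ?w = "enn2real (W t)"
      have "(\<integral>\<^sup>+\<xi>. ennreal (x \<xi> powr \<alpha> * y (t - \<xi>) powr \<beta> * w (\<xi>, t - \<xi>) powr \<pi>) \<partial>lborel)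
          \<le> ennreal (?h powr \<rho> * ?w powr \<pi>)"
      proof (rule holder_refined)
        show "(\<integral>\<^sup>+\<xi>. ennreal (x \<xi> * y (t - \<xi>)) \<partial>lborel) = ennreal ?h"
          using elim by (simp add: H_def[symmetric] ennreal_enn2real_if)
        show "(\<integral>\<^sup>+\<xi>. ennreal (w (\<xi>, t - \<xi>)) \<partial>lborel) = ennreal ?w"
          using elim by (simp add: W_def[symmetric] ennreal_enn2real_if)
      qed (use nn exps x1 y_shift in auto)
      \<comment> \<open>Pulling out the power \<rho> + \<pi> leaves a geometric mean with weights of
        sum 1, which is at most G.\<close>
      also have "?h powr \<rho> * ?w powr \<pi> = (?h powr (q * \<rho>) * ?w powr (q * \<pi>)) powr (\<rho> + \<pi>)"
        using exps by (simp add: powr_mult powr_powr q_def)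
      also have "\<dots> \<le> G t powr (\<rho> + \<pi>)"
      proof (rule powr_mono2)
        show "?h powr (q * \<rho>) * ?w powr (q * \<pi>) \<le> G t"
          using weighted_am_gm_4[of ?h ?w 1 1 "q * \<rho>" "q * \<pi>" 0 0] q exps by (simp add: G_def)
      qed (use exps in auto)
      finally show ?case by (simp add: ennreal_leI)
    qed
  qed
qed

text \<open>Substituting t = \<xi> + \<eta> makes the phase depend on t alone. The operator uses the
  positive exponential and \<open>fourier\<close> the negative one, hence the argument -x.\<close>

lemma
  fixes h :: "real \<times> real \<Rightarrow> complex"
  assumes h: "integrable lborel h"
  shows integrable_shear: "integrable lborel (\<lambda>t. LINT \<xi>|lborel. h (\<xi>, t - \<xi>))"
    and integral_shear_exp: "(LINT z|lborel. h z * exp (2 * of_real pi * \<i> * of_real (fst z + snd z) * of_real x))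
      = fourier (\<lambda>t. LINT \<xi>|lborel. h (\<xi>, t - \<xi>)) (- x)"
proof -
  have hb: "h \<in> borel_measurable borel" using h by (auto dest: borel_measurable_integrable)
  then have [measurable]: "h \<in> borel_measurable (borel \<Otimes>\<^sub>M borel)" by (simp add: borel_prod)
  let ?e = "\<lambda>t. exp (2 * of_real pi * \<i> * of_real t * of_real x) :: complex"
  have ne: "norm (?e t) = 1" for t
    using norm_fourier_kernel[of "- t" x] by simp
  have int: "integrable (lborel \<Otimes>\<^sub>M lborel) (\<lambda>(t, \<xi>). h (\<xi>, t - \<xi>))"
  proof (rule integrableI_bounded)
    show "(\<lambda>(t, \<xi>). h (\<xi>, t - \<xi>)) \<in> borel_measurable (lborel \<Otimes>\<^sub>M lborel)" by measurable
    have "(\<integral>\<^sup>+z. ennreal (norm (case z of (t, \<xi>) \<Rightarrow> h (\<xi>, t - \<xi>))) \<partial>(lborel \<Otimes>\<^sub>M lborel)) =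
        (\<integral>\<^sup>+t. (\<integral>\<^sup>+\<xi>. ennreal (norm (h (\<xi>, t - \<xi>))) \<partial>lborel) \<partial>lborel)"
      by (subst lborel.nn_integral_fst[symmetric]) auto
    also have "\<dots> = (\<integral>\<^sup>+z. ennreal (norm (h z)) \<partial>lborel)"
      using hb by (subst nn_integral_shear[of "\<lambda>z. ennreal (norm (h z))"]) auto
    also have "\<dots> < \<infinity>" using h by (simp add: integrable_iff_bounded)
    finally show "(\<integral>\<^sup>+z. ennreal (norm (case z of (t, \<xi>) \<Rightarrow> h (\<xi>, t - \<xi>))) \<partial>(lborel \<Otimes>\<^sub>M lborel)) < \<infinity>" .
  qed
  then show "integrable lborel (\<lambda>t. LINT \<xi>|lborel. h (\<xi>, t - \<xi>))"
    using lborel_pair.integrable_fst[OF int] by simp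
  have inte: "integrable (lborel \<Otimes>\<^sub>M lborel) (\<lambda>(t, \<xi>). h (\<xi>, t - \<xi>) * ?e t)"
  proof (rule Bochner_Integration.integrable_bound[OF int])
    show "(\<lambda>(t, \<xi>). h (\<xi>, t - \<xi>) * ?e t) \<in> borel_measurable (lborel \<Otimes>\<^sub>M lborel)" by measurable
  qed (auto simp: norm_mult ne)
  have he: "integrable (lborel \<Otimes>\<^sub>M lborel) (\<lambda>(\<xi>, \<eta>). h (\<xi>, \<eta>) * ?e (\<xi> + \<eta>))"
  proof (rule Bochner_Integration.integrable_bound)
    show "integrable (lborel \<Otimes>\<^sub>M lborel) h" using h by (simp add: lborel_prod)
    show "(\<lambda>(\<xi>, \<eta>). h (\<xi>, \<eta>) * ?e (\<xi> + \<eta>)) \<in> borel_measurable (lborel \<Otimes>\<^sub>M lborel)" by measurable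
  qed (auto simp: norm_mult ne simp del: of_real_add)
  have "(LINT z|lborel. h z * ?e (fst z + snd z)) = (LINT z|(lborel \<Otimes>\<^sub>M lborel). (case z of (\<xi>, \<eta>) \<Rightarrow> h (\<xi>, \<eta>) * ?e (\<xi> + \<eta>)))"
    by (simp add: lborel_prod case_prod_beta')
  also have "\<dots> = (LINT \<xi>|lborel. (LINT \<eta>|lborel. h (\<xi>, \<eta>) * ?e (\<xi> + \<eta>)))"
    by (rule lborel_pair.integral_fst[OF he, symmetric])
  also have "\<dots> = (LINT \<xi>|lborel. (LINT t|lborel. h (\<xi>, t - \<xi>) * ?e t))"
  proof (rule Bochner_Integration.integral_cong[OF refl])
    fix \<xi> :: real
    show "(LINT \<eta>|lborel. h (\<xi>, \<eta>) * ?e (\<xi> + \<eta>)) = (LINT t|lborel. h (\<xi>, t - \<xi>) * ?e t)"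
      using lborel_integral_real_affine[of 1 "\<lambda>\<eta>. h (\<xi>, \<eta>) * ?e (\<xi> + \<eta>)" "- \<xi>"]
      by (simp del: of_real_add)
  qed
  also have "\<dots> = (LINT t|lborel. (LINT \<xi>|lborel. h (\<xi>, t - \<xi>) * ?e t))"
    by (rule lborel_pair.Fubini_integral[OF inte])
  also have "\<dots> = fourier (\<lambda>t. LINT \<xi>|lborel. h (\<xi>, t - \<xi>)) (- x)"
    by (simp add: fourier_def)
  finally show "(LINT z|lborel. h z * exp (2 * of_real pi * \<i> * of_real (fst z + snd z) * of_real x))
      = fourier (\<lambda>t. LINT \<xi>|lborel. h (\<xi>, t - \<xi>)) (- x)" .
qed

section \<open>Bilinear multipliers\<close>

lemma schwartz_borel_measurable:
  assumes "schwartz f"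
  shows "f \<in> borel_measurable borel"
proof (rule borel_measurable_continuous_onI)
  have "(f has_vector_derivative nth_deriv (Suc 0) f x) (at x)" for x
    using assms unfolding schwartz_def by (metis nth_deriv.simps(1))
  then show "continuous_on UNIV f"
    by (meson continuous_at_imp_continuous_on has_vector_derivative_continuous)
qed

lemma schwartz_bound:
  assumes "schwartz f"
  obtains C where "C > 0" "\<And>x. (1 + x\<^sup>2) * norm (f x) \<le> C"
proof -
  have "\<forall>n. \<exists>C. \<forall>x. \<bar>x\<bar> ^ n * norm (f x) \<le> C"
    using assms unfolding schwartz_def by (metis nth_deriv.simps(1))
  then obtain C0 C2 where C: "\<And>x. \<bar>x\<bar> ^ 0 * norm (f x) \<le> C0" "\<And>x. \<bar>x\<bar> ^ 2 * norm (f x) \<le> C2"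
    by metis
  have "(1 + x\<^sup>2) * norm (f x) \<le> \<bar>C0 + C2\<bar> + 1" for x
    using C[of x] by (simp add: algebra_simps)
  then show ?thesis using that[of "\<bar>C0 + C2\<bar> + 1"] by simp
qed

lemma schwartz_integrable:
  assumes "schwartz f"
  shows "integrable lborel f"
proof -
  obtain C where C: "C > 0" "\<And>x. (1 + x\<^sup>2) * norm (f x) \<le> C"
    using schwartz_bound[OF assms] by blast
  have pos: "1 + x\<^sup>2 > 0" for x :: real by (simp add: add_pos_nonneg)
  have "integrable lborel (\<lambda>x::real. inverse (1 + x\<^sup>2))"
    using integrable_inverse_1_plus_square by (simp add: set_integrable_def)
  then have "integrable lborel (\<lambda>x::real. C * inverse (1 + x\<^sup>2))"
    by (rule integrable_mult_right)
  then show ?thesis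
  proof (rule Bochner_Integration.integrable_bound)
    show "f \<in> borel_measurable lborel" using schwartz_borel_measurable[OF assms] by simp
    have "norm (f x) \<le> C * inverse (1 + x\<^sup>2)" for x
      using C(2)[of x] pos[of x] by (simp add: field_simps)
    then show "AE x in lborel. norm (f x) \<le> norm (C * inverse (1 + x\<^sup>2))"
      by (intro AE_I2) (metis abs_ge_self order_trans real_norm_def)
  qed
qed

text \<open>A Schwartz function is bounded and integrable, and |f|^p is |f|^(p-1) times |f|.\<close>

lemma schwartz_powr_finite:
  assumes f: "schwartz f" and p: "1 \<le> p"
  shows "(\<integral>\<^sup>+x. ennreal (norm (f x) powr p) \<partial>lborel) < \<infinity>"
proof -
  obtain C where C: "C > 0" "\<And>x. (1 + x\<^sup>2) * norm (f x) \<le> C"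
    using schwartz_bound[OF f] by blast
  have [measurable]: "f \<in> borel_measurable borel" by (rule schwartz_borel_measurable[OF f])
  have le: "norm (f x) powr p \<le> C powr (p - 1) * norm (f x)" for x
  proof (cases "f x = 0")
    case False
    have "norm (f x) \<le> C"
      using C(2)[of x] by (simp add: algebra_simps) (smt (verit) mult_nonneg_nonneg norm_ge_zero zero_le_power2)
    then have "norm (f x) powr (p - 1) \<le> C powr (p - 1)"
      using p by (intro powr_mono2) auto
    moreover have "norm (f x) powr p = norm (f x) powr (p - 1) * norm (f x)"
      using False by (simp add: powr_diff)
    ultimately show ?thesis by (simp add: mult_right_mono)
  qed simp
  have "(\<integral>\<^sup>+x. ennreal (norm (f x) powr p) \<partial>lborel) \<le> (\<integral>\<^sup>+x. ennreal (C powr (p - 1)) * ennreal (norm (f x)) \<partial>lborel)"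
    using le by (intro nn_integral_mono) (simp add: ennreal_leI flip: ennreal_mult)
  also have "\<dots> = ennreal (C powr (p - 1)) * (\<integral>\<^sup>+x. ennreal (norm (f x)) \<partial>lborel)"
    by (rule nn_integral_cmult) measurable
  also have "\<dots> < \<infinity>"
    using schwartz_integrable[OF f] by (simp add: integrable_iff_bounded ennreal_mult_less_top)
  finally show ?thesis .
qed

text \<open>Completion does not change nonnegative integrals, so norms over \<open>lebesgue\<close>
  can be computed over \<open>lborel\<close>, where the Fubini arguments take place.\<close>

lemma Lp_norm_ennreal:
  assumes "0 < p"
  shows "Lp_norm (ennreal p) f lebesgue = (let I = (\<integral>\<^sup>+x. ennreal (norm (f x) powr p) \<partial>lborel)
    in if I = \<infinity> then \<infinity> else ennreal (enn2real I powr (1 / p)))"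
  using assms by (simp add: Lp_norm_def nn_integral_completion Let_def)

lemma fourier_eq_0_AE:
  assumes "f \<in> borel_measurable borel" "AE x in lborel. f x = 0"
  shows "fourier f \<xi> = 0"
proof -
  have "(\<integral>\<^sup>+x. ennreal (norm (f x)) \<partial>lborel) = (\<integral>\<^sup>+x. 0 \<partial>(lborel :: real measure))"
    by (intro nn_integral_cong_AE) (use assms in auto)
  then show ?thesis using ennreal_norm_fourier_le[of f \<xi>] by simp
qed

text \<open>Homogeneity removes the normalisation in \<open>hausdorff_young_majorant\<close>: the
  norm N of a Schwartz function is finite, and f / N is normalised unless N = 0.\<close>

lemma P_class_fourier_majorant:
  fixes p :: real
  assumes p: "1 \<le> p" "p \<le> 2"
  shows "\<exists>C>0. \<forall>f\<in>P_class. \<exists>N\<ge>0. Lp_norm (ennreal p) f lebesgue = ennreal N \<and>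
    (\<exists>h. unit_mass h \<and>
      (\<forall>\<xi>. norm (fourier f \<xi>) \<le> C * N * h \<xi> powr (1 - 1 / p)))"
proof -
  obtain C where C: "C > 0" and hy: "\<And>f. integrable lborel f \<Longrightarrow> (\<integral>\<^sup>+x. ennreal (norm (f x) powr p) \<partial>lborel) \<le> 1 \<Longrightarrow>
    \<exists>h. unit_mass h \<and>
      (\<forall>\<xi>. norm (fourier f \<xi>) \<le> C * h \<xi> powr (1 - 1 / p))"
    using hausdorff_young_majorant[OF p] by metis
  have "\<exists>N\<ge>0. Lp_norm (ennreal p) f lebesgue = ennreal N \<and>
    (\<exists>h. unit_mass h \<and>
      (\<forall>\<xi>. norm (fourier f \<xi>) \<le> C * N * h \<xi> powr (1 - 1 / p)))" if "f \<in> P_class" for f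
  proof -
    have f: "schwartz f" using that by (simp add: P_class_def)
    have [measurable]: "f \<in> borel_measurable borel" by (rule schwartz_borel_measurable[OF f])
    define I where "I = enn2real (\<integral>\<^sup>+x. ennreal (norm (f x) powr p) \<partial>lborel)"
    have I0: "0 \<le> I" by (simp add: I_def)
    have I: "(\<integral>\<^sup>+x. ennreal (norm (f x) powr p) \<partial>lborel) = ennreal I"
      using schwartz_powr_finite[OF f p(1)] by (simp add: I_def ennreal_enn2real_if)
    define N where "N = I powr (1 / p)"
    have N: "0 \<le> N" "Lp_norm (ennreal p) f lebesgue = ennreal N"
      using p I0 by (auto simp: Lp_norm_ennreal Let_def I N_def)
    show ?thesis
    proof (cases "I = 0")
      \<comment> \<open>Division by N is impossible here, but f vanishes almost everywhere and so
        does its transform, everywhere; the zero density suffices.\<close>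
      case True
      then have "AE x in lborel. ennreal (norm (f x) powr p) = 0"
        using I by (subst nn_integral_0_iff_AE[symmetric]) auto
      then have "AE x in lborel. f x = 0"
        by eventually_elim (simp add: ennreal_eq_0_iff)
      then have "fourier f \<xi> = 0" for \<xi> by (intro fourier_eq_0_AE) auto
      then show ?thesis using N C
        by (intro exI[of _ N] conjI exI[of _ "\<lambda>_. 0"] unit_massI) auto
    next
      case False
      with I0 have I1: "I > 0" by simp
      then have N1: "N > 0" "N powr p = I" using p by (auto simp: N_def powr_powr)
      let ?g = "\<lambda>x. of_real (1 / N) * f x"
      have "integrable lborel ?g" using schwartz_integrable[OF f] by auto
      moreover have "(\<integral>\<^sup>+x. ennreal (norm (?g x) powr p) \<partial>lborel) \<le> 1"
      proof -
        have "(\<integral>\<^sup>+x. ennreal (norm (?g x) powr p) \<partial>lborel) =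
          (\<integral>\<^sup>+x. ennreal (1 / I) * ennreal (norm (f x) powr p) \<partial>lborel)"
          using N1 I1 by (intro nn_integral_cong)
            (simp add: norm_mult norm_divide powr_divide flip: ennreal_mult)
        also have "\<dots> = ennreal (1 / I) * ennreal I"
          by (subst nn_integral_cmult) (auto simp: I)
        also have "\<dots> = 1" using I1 by (simp flip: ennreal_mult)
        finally show ?thesis by simp
      qed
      ultimately obtain h where h: "unit_mass h"
        "\<And>\<xi>. norm (fourier ?g \<xi>) \<le> C * h \<xi> powr (1 - 1 / p)"
        using hy by metis
      have "norm (fourier f \<xi>) \<le> C * N * h \<xi> powr (1 - 1 / p)" for \<xi>
        using h(2)[of \<xi>] N1 unfolding fourier_cmult by (simp add: norm_mult norm_divide field_simps)
      with N h show ?thesis by blast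
    qed
  qed
  with C show ?thesis by blast
qed

text \<open>Hausdorff-Young in the form in which it is applied to the integral of the symbol along
  lines: of F only a majorant is known, and |F|^q \<le> N^q G makes F / N normalised.\<close>

lemma hausdorff_young_scaled:
  fixes q :: real
  assumes q: "1 < q" "q \<le> 2"
  shows "\<exists>C>0. \<forall>F G N. integrable lborel F \<longrightarrow> unit_mass G \<longrightarrow> 0 \<le> N \<longrightarrow>
    (AE t in lborel. norm (F t) \<le> N * G t powr (1 / q)) \<longrightarrow>
    (\<integral>\<^sup>+\<xi>. ennreal (norm (fourier F \<xi>) powr (q / (q - 1))) \<partial>lborel) \<le> ennreal (C * N powr (q / (q - 1)))"
proof -
  obtain C where C: "C > 0" "\<And>f. integrable lborel f \<Longrightarrow> (\<integral>\<^sup>+x. ennreal (norm (f x) powr q) \<partial>lborel) \<le> 1 \<Longrightarrow>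
    (\<integral>\<^sup>+\<xi>. ennreal (norm (fourier f \<xi>) powr (q / (q - 1))) \<partial>lborel) \<le> ennreal C"
    using hausdorff_young[OF q] by metis
  have "(\<integral>\<^sup>+\<xi>. ennreal (norm (fourier F \<xi>) powr (q / (q - 1))) \<partial>lborel) \<le> ennreal (C * N powr (q / (q - 1)))"
    if F: "integrable lborel F" and UG: "unit_mass G" and N: "0 \<le> N"
      and le: "AE t in lborel. norm (F t) \<le> N * G t powr (1 / q)" for F G N
  proof -
    note [measurable] = unit_massD(1)[OF UG]
    note G = unit_massD(2,3)[OF UG]
    let ?s = "q / (q - 1)"
    have [measurable]: "F \<in> borel_measurable borel" using F by (auto dest: borel_measurable_integrable)
    note [measurable] = fourier_measurable[of F]
    show ?thesis
    proof (cases "N = 0")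
      case True
      then have "AE t in lborel. F t = 0" using le by simp
      then have "fourier F \<xi> = 0" for \<xi> by (intro fourier_eq_0_AE) auto
      then show ?thesis by simp
    next
      case False
      with N have N: "N > 0" by simp
      let ?f = "\<lambda>t. of_real (1 / N) * F t"
      have "(\<integral>\<^sup>+t. ennreal (norm (?f t) powr q) \<partial>lborel) \<le> (\<integral>\<^sup>+t. ennreal (G t) \<partial>lborel)"
        using le
      proof (intro nn_integral_mono_AE, eventually_elim)
        case (elim t)
        then have "norm (?f t) \<le> G t powr (1 / q)"
          using N by (simp add: norm_mult norm_divide field_simps)
        then have "norm (?f t) powr q \<le> (G t powr (1 / q)) powr q"
          using q by (intro powr_mono2) auto
        then show ?case using q G(1)[of t] by (intro ennreal_leI) (simp add: powr_powr)
      qed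
      then have "(\<integral>\<^sup>+t. ennreal (norm (?f t) powr q) \<partial>lborel) \<le> 1" using G(2) by (rule order_trans)
      then have b: "(\<integral>\<^sup>+\<xi>. ennreal (norm (fourier ?f \<xi>) powr ?s) \<partial>lborel) \<le> ennreal C"
        using F by (intro C(2)) auto
      have "(\<integral>\<^sup>+\<xi>. ennreal (norm (fourier F \<xi>) powr ?s) \<partial>lborel) =
          (\<integral>\<^sup>+\<xi>. ennreal (N powr ?s) * ennreal (norm (fourier ?f \<xi>) powr ?s) \<partial>lborel)"
        unfolding fourier_cmult using N
        by (intro nn_integral_cong) (simp add: norm_mult norm_divide powr_divide flip: ennreal_mult)
      also have "\<dots> = ennreal (N powr ?s) * (\<integral>\<^sup>+\<xi>. ennreal (norm (fourier ?f \<xi>) powr ?s) \<partial>lborel)"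
        unfolding fourier_cmult by (rule nn_integral_cmult) measurable
      also have "\<dots> \<le> ennreal (N powr ?s) * ennreal C"
        by (intro mult_left_mono b) simp
      also have "\<dots> = ennreal (C * N powr ?s)"
        using C(1) by (simp add: mult.commute flip: ennreal_mult)
      finally show ?thesis .
    qed
  qed
  with C(1) show ?thesis by blast
qed

section \<open>Borel representative of the symbol and integrability of the integrand\<close>

lemma lebesgue_ex_borel_complex:
  fixes m :: "'a::euclidean_space \<Rightarrow> complex"
  assumes "m \<in> borel_measurable lebesgue"
  obtains m' where "m' \<in> borel_measurable borel" "AE z in lborel. m z = m' z"
proof -
  have "(\<lambda>z. Re (m z)) \<in> borel_measurable lebesgue" "(\<lambda>z. Im (m z)) \<in> borel_measurable lebesgue"
    using assms by measurable
  then obtain a b where [measurable]: "a \<in> borel_measurable borel" "b \<in> borel_measurable borel"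
    and "AE z in lborel. Re (m z) = a z" "AE z in lborel. Im (m z) = b z"
    by (auto dest!: completion_ex_borel_measurable_real)
  then have "AE z in lborel. m z = Complex (a z) (b z)"
    by (auto simp: complex_eq_iff)
  then show thesis
    by (intro that[of "\<lambda>z. Complex (a z) (b z)"]) (auto simp: Complex_eq)
qed

text \<open>The symbol is only Lebesgue measurable. Replacing it by an almost everywhere equal Borel
  function leaves every value of the operator unchanged and gives access to product
  measures.\<close>

lemma bilin_op_borel_version:
  assumes [measurable]: "fourier f \<in> borel_measurable borel" "fourier g \<in> borel_measurable borel"
    and m [measurable]: "m \<in> borel_measurable lebesgue" and m' [measurable]: "m' \<in> borel_measurable borel"
    and ae: "AE z in lborel. m z = m' z"
  shows "bilin_op m f g x = (LINT z|lborel. fourier f (fst z) * fourier g (snd z) * m' z *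
       exp (2 * of_real pi * \<i> * of_real (fst z + snd z) * of_real x))"
proof -
  let ?a = "\<lambda>z::real \<times> real. fourier f (fst z) * fourier g (snd z)"
  let ?e = "\<lambda>z::real \<times> real. exp (2 * of_real pi * \<i> * of_real (fst z + snd z) * of_real x) :: complex"
  have a: "?a \<in> borel_measurable borel" and e: "?e \<in> borel_measurable borel"
    by (simp_all flip: borel_prod)
  have [measurable]: "?a \<in> borel_measurable lebesgue" "?e \<in> borel_measurable lebesgue"
      "m' \<in> borel_measurable lebesgue"
    using a e m' by (auto intro: measurable_completion)
  have "bilin_op m f g x = (LINT z|lebesgue. ?a z * m' z * ?e z)"
    unfolding bilin_op_def
  proof (rule integral_cong_AE)
    show "AE z in lebesgue. ?a z * m z * ?e z = ?a z * m' z * ?e z"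
      using ae by (intro AE_completion) auto
  qed measurable
  also have "\<dots> = (LINT z|lborel. ?a z * m' z * ?e z)"
    using a e by (intro integral_completion) (auto intro!: borel_measurable_times)
  finally show ?thesis .
qed

lemma P_class_fourier:
  assumes "f \<in> P_class"
  obtains D R where "D > 0" "R > 0" "\<And>\<xi>. norm (fourier f \<xi>) \<le> D * indicator {-R..R} \<xi>"
    "fourier f \<in> borel_measurable borel"
proof -
  have f: "schwartz f" "continuous_on UNIV (fourier f)" "compact (closure {\<xi>. fourier f \<xi> \<noteq> 0})"
    using assms by (auto simp: P_class_def)
  from f(3) have "bounded {\<xi>. fourier f \<xi> \<noteq> 0}"
    by (meson bounded_subset closure_subset compact_imp_bounded)
  then obtain R where R: "R > 0" "\<And>\<xi>. fourier f \<xi> \<noteq> 0 \<Longrightarrow> norm \<xi> \<le> R"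
    by (auto simp: bounded_pos)
  show thesis
  proof (rule that[of "(LINT x|lborel. norm (f x)) + 1" R])
    show "(LINT x|lborel. norm (f x)) + 1 > 0" by (simp add: add_nonneg_pos)
    show "fourier f \<in> borel_measurable borel" using f(2) by (rule borel_measurable_continuous_onI)
    show "norm (fourier f \<xi>) \<le> ((LINT x|lborel. norm (f x)) + 1) * indicator {-R..R} \<xi>" for \<xi>
    proof (cases "fourier f \<xi> = 0")
      case False
      then have "\<xi> \<in> {-R..R}" using R(2)[of \<xi>] by auto
      then show ?thesis using norm_fourier_le[of f \<xi>] by simp
    qed (simp add: add_nonneg_pos less_imp_le)
  qed (rule R)
qed

text \<open>For p \<ge> 1 one has |m| \<le> 1 + |m|^p, and the constant 1 is integrable over the
  compact set K.\<close>

lemma integrable_compact_times_Lp: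
  fixes m u :: "'a::euclidean_space \<Rightarrow> complex"
  assumes [measurable]: "m \<in> borel_measurable borel" "u \<in> borel_measurable borel" and p: "1 \<le> p"
    and mp: "(\<integral>\<^sup>+z. ennreal (norm (m z) powr p) \<partial>lborel) < \<infinity>"
    and K: "compact K" and D: "0 \<le> D" "\<And>z. norm (u z) \<le> D * indicator K z"
  shows "integrable lborel (\<lambda>z. u z * m z)"
proof (rule integrableI_bounded)
  have [measurable]: "K \<in> sets borel" using K by (intro borel_closed compact_imp_closed)
  have le: "norm (u z * m z) \<le> D * indicator K z + D * norm (m z) powr p" for z
  proof (cases "norm (m z) \<le> 1")
    case True
    then have "norm (u z * m z) \<le> D * indicator K z * 1"
      unfolding norm_mult using D by (intro mult_mono) auto
    then show ?thesis using D(1) by (simp add: add_increasing2)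
  next
    case False
    then have "norm (m z) powr 1 \<le> norm (m z) powr p" using p by (intro powr_mono) auto
    moreover have "norm (u z) \<le> D"
      using D(2)[of z] D(1) by (cases "z \<in> K") auto
    ultimately have "norm (u z * m z) \<le> D * norm (m z) powr p"
      unfolding norm_mult using D(1) False by (intro mult_mono) auto
    then show ?thesis using D(1) by (simp add: add_increasing)
  qed
  have "(\<integral>\<^sup>+z. ennreal (norm (u z * m z)) \<partial>lborel) \<le>
      (\<integral>\<^sup>+z. ennreal D * indicator K z + ennreal D * ennreal (norm (m z) powr p) \<partial>lborel)"
  proof (intro nn_integral_mono)
    fix z
    have "ennreal D * indicator K z + ennreal D * ennreal (norm (m z) powr p) =
        ennreal (D * indicator K z + D * norm (m z) powr p)"
      using D(1) by (simp add: ennreal_mult ennreal_indicator)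
    then show "ennreal (norm (u z * m z)) \<le> ennreal D * indicator K z + ennreal D * ennreal (norm (m z) powr p)"
      using le[of z] by (simp add: ennreal_leI)
  qed
  also have "\<dots> = ennreal D * emeasure lborel K + ennreal D * (\<integral>\<^sup>+z. ennreal (norm (m z) powr p) \<partial>lborel)"
    by (simp add: nn_integral_add nn_integral_cmult)
  also have "\<dots> < \<infinity>"
    using mp emeasure_compact_finite[OF K] by (simp add: ennreal_mult_less_top)
  finally show "(\<integral>\<^sup>+z. ennreal (norm (u z * m z)) \<partial>lborel) < \<infinity>" .
qed measurable

text \<open>Common core of the finite and the infinite case: the operator is a reflected Fourier
  transform of some F whose majorant has exponent 1 - \<sigma>, where \<sigma> stands for 1/p3. The
  constant K is fixed before f and g.\<close>

lemma bilin_op_fourier_majorant: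
  fixes p p1 p2 \<sigma> :: real
  assumes p: "1 \<le> p1" "p1 \<le> p" "1 \<le> p2" "p2 \<le> p" "p \<le> 2"
    and \<sigma>: "1 / p1 + 1 / p2 - 2 / p = \<sigma>" "\<sigma> \<le> 1 - 1 / p"
    and m: "in_Lp2 (ennreal p) m"
  shows "\<exists>K>0. \<forall>f\<in>P_class. \<forall>g\<in>P_class. \<exists>N1\<ge>0. \<exists>N2\<ge>0. \<exists>F G.
      Lp_norm (ennreal p1) f lebesgue = ennreal N1 \<and> Lp_norm (ennreal p2) g lebesgue = ennreal N2 \<and>
      integrable lborel F \<and> unit_mass G \<and> bilin_op m f g = (\<lambda>x. fourier F (- x)) \<and>
      (AE t in lborel. norm (F t) \<le> K * N1 * N2 * G t powr (1 - \<sigma>))"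
proof -
  have p0: "p > 0" and le2: "p1 \<le> 2" "p2 \<le> 2" using p by simp_all
  obtain C1 where C1: "C1 > 0" and maj1: "\<forall>f\<in>P_class. \<exists>N\<ge>0. Lp_norm (ennreal p1) f lebesgue = ennreal N \<and>
    (\<exists>h. unit_mass h \<and> (\<forall>\<xi>. norm (fourier f \<xi>) \<le> C1 * N * h \<xi> powr (1 - 1 / p1)))"
    using P_class_fourier_majorant[OF p(1) le2(1)] by blast
  obtain C2 where C2: "C2 > 0" and maj2: "\<forall>f\<in>P_class. \<exists>N\<ge>0. Lp_norm (ennreal p2) f lebesgue = ennreal N \<and>
    (\<exists>h. unit_mass h \<and> (\<forall>\<xi>. norm (fourier f \<xi>) \<le> C2 * N * h \<xi> powr (1 - 1 / p2)))"
    using P_class_fourier_majorant[OF p(3) le2(2)] by blast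
  have mm: "m \<in> borel_measurable lebesgue" using m by (simp add: in_Lp2_def)
  then obtain m' where m' [measurable]: "m' \<in> borel_measurable borel" and ae: "AE z in lborel. m z = m' z"
    using lebesgue_ex_borel_complex by blast
  have "(\<integral>\<^sup>+z. ennreal (norm (m z) powr p) \<partial>lborel) < \<infinity>"
    using m p0 by (auto simp: in_Lp2_def Lp_norm_def nn_integral_completion Let_def less_top split: if_splits)
  moreover have "(\<integral>\<^sup>+z. ennreal (norm (m z) powr p) \<partial>lborel) = (\<integral>\<^sup>+z. ennreal (norm (m' z) powr p) \<partial>lborel)"
    using ae by (intro nn_integral_cong_AE) auto
  ultimately have mfin: "(\<integral>\<^sup>+z. ennreal (norm (m' z) powr p) \<partial>lborel) < \<infinity>" by simp
  \<comment> \<open>The summand 1 makes J positive even for a symbol that vanishes almost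
    everywhere.\<close>
  define J where "J = enn2real (\<integral>\<^sup>+z. ennreal (norm (m' z) powr p) \<partial>lborel) + 1"
  have J0: "J > 0" by (simp add: J_def add_nonneg_pos)
  have J: "(\<integral>\<^sup>+z. ennreal (norm (m' z) powr p) \<partial>lborel) \<le> ennreal J"
  proof -
    have "(\<integral>\<^sup>+z. ennreal (norm (m' z) powr p) \<partial>lborel) = ennreal (J - 1)"
      using mfin by (simp add: J_def)
    then show ?thesis by (simp add: ennreal_leI)
  qed
  define w where "w z = 1 / J * norm (m' z) powr p" for z
  have w [measurable]: "w \<in> borel_measurable borel" unfolding w_def[abs_def] by measurable
  have w0: "0 \<le> w z" for z using J0 by (simp add: w_def)
  have "(\<integral>\<^sup>+z. ennreal (w z) \<partial>lborel) = ennreal (1 / J) * (\<integral>\<^sup>+z. ennreal (norm (m' z) powr p) \<partial>lborel)"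
    unfolding w_def using J0 by (subst nn_integral_cmult[symmetric]) (simp_all flip: ennreal_mult)
  also have "\<dots> \<le> ennreal (1 / J) * ennreal J" by (intro mult_left_mono J) simp
  also have "\<dots> = 1" using J0 by (simp flip: ennreal_mult)
  finally have w1: "(\<integral>\<^sup>+z. ennreal (w z) \<partial>lborel) \<le> 1" .
  have mw: "norm (m' z) = J powr (1 / p) * w z powr (1 / p)" for z
    using J0 p0 by (simp add: w_def powr_powr powr_mult powr_divide)
  define K where "K = C1 * C2 * J powr (1 / p)"
  have "\<exists>N1\<ge>0. \<exists>N2\<ge>0. \<exists>F G.
      Lp_norm (ennreal p1) f lebesgue = ennreal N1 \<and> Lp_norm (ennreal p2) g lebesgue = ennreal N2 \<and>
      integrable lborel F \<and> unit_mass G \<and> bilin_op m f g = (\<lambda>x. fourier F (- x)) \<and>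
      (AE t in lborel. norm (F t) \<le> K * N1 * N2 * G t powr (1 - \<sigma>))"
    if f: "f \<in> P_class" and g: "g \<in> P_class" for f g
  proof -
    obtain N1 h1 where N1: "0 \<le> N1" "Lp_norm (ennreal p1) f lebesgue = ennreal N1" and h1: "unit_mass h1"
      and f1: "\<And>\<xi>. norm (fourier f \<xi>) \<le> C1 * N1 * h1 \<xi> powr (1 - 1 / p1)"
      using bspec[OF maj1 f] by blast
    note [measurable] = unit_massD(1)[OF h1]
    obtain N2 h2 where N2: "0 \<le> N2" "Lp_norm (ennreal p2) g lebesgue = ennreal N2" and h2: "unit_mass h2"
      and g2: "\<And>\<xi>. norm (fourier g \<xi>) \<le> C2 * N2 * h2 \<xi> powr (1 - 1 / p2)"
      using bspec[OF maj2 g] by blast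
    note [measurable] = unit_massD(1)[OF h2]
    obtain D1 R1 where D1: "D1 > 0" "R1 > 0" "\<And>\<xi>. norm (fourier f \<xi>) \<le> D1 * indicator {-R1..R1} \<xi>"
      and fm [measurable]: "fourier f \<in> borel_measurable borel"
      using P_class_fourier[OF f] by blast
    obtain D2 R2 where D2: "D2 > 0" "R2 > 0" "\<And>\<xi>. norm (fourier g \<xi>) \<le> D2 * indicator {-R2..R2} \<xi>"
      and gm [measurable]: "fourier g \<in> borel_measurable borel"
      using P_class_fourier[OF g] by blast
    \<comment> \<open>The integrand without the exponential. The compact supports of the two
      transforms make it integrable, which admits the shear and Fubini.\<close>
    define H where "H z = fourier f (fst z) * fourier g (snd z) * m' z" for z
    have "integrable lborel H"
      unfolding H_def[abs_def]
    proof (rule integrable_compact_times_Lp[OF m' _ _ mfin])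
      show "(\<lambda>z. fourier f (fst z) * fourier g (snd z)) \<in> borel_measurable borel"
        by (simp flip: borel_prod)
      show "compact ({-R1..R1} \<times> {-R2..R2})" by (intro compact_Times compact_Icc)
      show "norm (fourier f (fst z) * fourier g (snd z)) \<le> D1 * D2 * indicator ({-R1..R1} \<times> {-R2..R2}) z" for z
      proof -
        have "norm (fourier f (fst z) * fourier g (snd z)) \<le>
            (D1 * indicator {-R1..R1} (fst z)) * (D2 * indicator {-R2..R2} (snd z))"
          unfolding norm_mult using D1 D2 by (intro mult_mono) auto
        then show ?thesis by (simp add: indicator_times mult_ac)
      qed
    qed (use p D1 D2 in auto)
    note Hint = this
    define F where "F t = (LINT \<xi>|lborel. H (\<xi>, t - \<xi>))" for t
    have Fint: "integrable lborel F" using integrable_shear[OF Hint] by (simp add: F_def[abs_def])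
    have B: "bilin_op m f g = (\<lambda>x. fourier F (- x))"
      using integral_shear_exp[OF Hint]
      by (simp add: fun_eq_iff bilin_op_borel_version[OF fm gm mm m' ae] H_def[symmetric] F_def[abs_def])
    have N: "0 \<le> K * N1 * N2" using C1 C2 N1 N2 by (simp add: K_def)
    \<comment> \<open>These inequalities yield \<rho> \<le> \<alpha> and \<rho> \<le> \<beta> for
      the next step, after inserting the scaling relation.\<close>
    have iP: "1 / p \<le> 1 / p1" "1 / p \<le> 1 / p2" using p by (auto intro!: divide_left_mono)
    obtain G where G: "unit_mass G"
      and Gle: "AE t in lborel. (\<integral>\<^sup>+\<xi>. ennreal (h1 \<xi> powr (1 - 1 / p1) * h2 (t - \<xi>) powr (1 - 1 / p2) *
        w (\<xi>, t - \<xi>) powr (1 / p)) \<partial>lborel) \<le> ennreal (G t powr ((1 - 1 / p - \<sigma>) + 1 / p))"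
      by (rule convolution_majorant[OF h1 h2 w w0 w1, of "1 - 1 / p - \<sigma>" "1 - 1 / p1" "1 - 1 / p2" "1 / p"])
        (use \<sigma> p0 iP in auto)
    have "AE t in lborel. norm (F t) \<le> K * N1 * N2 * G t powr (1 - \<sigma>)"
      using Gle
    proof eventually_elim
      case (elim t)
      let ?E = "\<lambda>\<xi>. h1 \<xi> powr (1 - 1 / p1) * h2 (t - \<xi>) powr (1 - 1 / p2) * w (\<xi>, t - \<xi>) powr (1 / p)"
      have [measurable]: "?E \<in> borel_measurable borel"
        using w by (simp flip: borel_prod)
      have le: "norm (H (\<xi>, t - \<xi>)) \<le> K * N1 * N2 * ?E \<xi>" for \<xi>
      proof -
        have "norm (H (\<xi>, t - \<xi>)) \<le> (C1 * N1 * h1 \<xi> powr (1 - 1 / p1)) *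
            (C2 * N2 * h2 (t - \<xi>) powr (1 - 1 / p2)) * norm (m' (\<xi>, t - \<xi>))"
          unfolding H_def norm_mult fst_conv snd_conv
          using C1 N1 by (intro mult_right_mono mult_mono f1 g2) auto
        then show ?thesis by (simp add: mw K_def mult_ac)
      qed
      have "ennreal (norm (F t)) \<le> (\<integral>\<^sup>+\<xi>. ennreal (norm (H (\<xi>, t - \<xi>))) \<partial>lborel)"
        unfolding F_def by (rule ennreal_norm_integral_le)
      also have "\<dots> \<le> (\<integral>\<^sup>+\<xi>. ennreal (K * N1 * N2) * ennreal (?E \<xi>) \<partial>lborel)"
        unfolding ennreal_mult'[OF N, symmetric] by (intro nn_integral_mono ennreal_leI le)
      also have "\<dots> = ennreal (K * N1 * N2) * (\<integral>\<^sup>+\<xi>. ennreal (?E \<xi>) \<partial>lborel)"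
        by (rule nn_integral_cmult) measurable
      also have "\<dots> \<le> ennreal (K * N1 * N2) * ennreal (G t powr ((1 - 1 / p - \<sigma>) + 1 / p))"
        by (intro mult_left_mono elim) simp
      also have "\<dots> = ennreal (K * N1 * N2 * G t powr (1 - \<sigma>))"
        using N by (simp add: ennreal_mult)
      finally show ?case using N by (simp add: ennreal_le_iff)
    qed
    with N1 N2 Fint B G show ?thesis
      by (intro exI[of _ N1] exI[of _ N2] exI[of _ F] exI[of _ G] conjI)
  qed
  moreover have "K > 0" using C1 C2 J0 by (simp add: K_def)
  ultimately show ?thesis by blast
qed

text \<open>Since p1 and p2 are at most 2, real parameters suffice and the convention for infinite
  p1 or p2 never enters. For \<open>p3 = \<infinity>\<close> the value
  \<open>enn2real (inverse p3)\<close> is 0, as intended.\<close>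

theorem mainTheorem6:
  fixes p1 p2 p :: real and p3 :: ennreal and m :: "real \<times> real \<Rightarrow> complex"
  assumes "1 \<le> p1" and "p1 \<le> p" and "1 \<le> p2" and "p2 \<le> p" and "p \<le> 2"
    and "p3 \<ge> conj_exp p"
    and "1 / p1 + 1 / p2 - 2 / p = enn2real (inverse p3)"
    and "in_Lp2 (ennreal p) m"
  shows "BM (ennreal p1) (ennreal p2) p3 m"
proof (cases "p3 = \<infinity>")
  case True
  \<comment> \<open>With \<sigma> = 0 the majorant is K N1 N2 G itself, so F is bounded in L^1 and
    the trivial sup bound of the transform applies.\<close>
  then have "1 / p1 + 1 / p2 - 2 / p = 0" "0 \<le> 1 - 1 / p" using assms by auto
  from bilin_op_fourier_majorant[OF assms(1-5) this assms(8)]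
  obtain K where K: "K > 0" "\<forall>f\<in>P_class. \<forall>g\<in>P_class. \<exists>N1\<ge>0. \<exists>N2\<ge>0. \<exists>F G.
      Lp_norm (ennreal p1) f lebesgue = ennreal N1 \<and> Lp_norm (ennreal p2) g lebesgue = ennreal N2 \<and>
      integrable lborel F \<and> unit_mass G \<and> bilin_op m f g = (\<lambda>x. fourier F (- x)) \<and>
      (AE t in lborel. norm (F t) \<le> K * N1 * N2 * G t powr (1 - 0))"
    by blast
  show ?thesis unfolding BM_def
  proof (intro exI[of _ K] conjI ballI K(1))
    fix f g assume "f \<in> P_class" "g \<in> P_class"
    from bspec[OF bspec[OF K(2) this(1)] this(2)] obtain N1 N2 F G where N: "0 \<le> N1" "0 \<le> N2"
      "Lp_norm (ennreal p1) f lebesgue = ennreal N1" "Lp_norm (ennreal p2) g lebesgue = ennreal N2"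
      and B: "bilin_op m f g = (\<lambda>x. fourier F (- x))"
      and UG: "unit_mass G"
      and le: "AE t in lborel. norm (F t) \<le> K * N1 * N2 * G t powr (1 - 0)" by blast
    note G = unit_massD[OF UG]
    have KN: "0 \<le> K * N1 * N2" using K(1) N by simp
    have "ennreal (norm (bilin_op m f g x)) \<le> ennreal (K * N1 * N2)" for x
    proof -
      have "ennreal (norm (bilin_op m f g x)) \<le> (\<integral>\<^sup>+t. ennreal (norm (F t)) \<partial>lborel)"
        unfolding B by (rule ennreal_norm_fourier_le)
      also have "\<dots> \<le> (\<integral>\<^sup>+t. ennreal (K * N1 * N2) * ennreal (G t) \<partial>lborel)"
        using le by (intro nn_integral_mono_AE, eventually_elim)
          (use G(2) KN in \<open>simp add: ennreal_leI flip: ennreal_mult\<close>)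
      also have "\<dots> = ennreal (K * N1 * N2) * (\<integral>\<^sup>+t. ennreal (G t) \<partial>lborel)"
        using G(1) by (intro nn_integral_cmult) simp
      also have "\<dots> \<le> ennreal (K * N1 * N2) * 1"
        by (intro mult_left_mono G) simp
      finally show ?thesis by simp
    qed
    then have "Lp_norm p3 (bilin_op m f g) lebesgue \<le> ennreal (K * N1 * N2)"
      using True by (auto simp: Lp_norm_def intro!: Inf_lower)
    then show "Lp_norm p3 (bilin_op m f g) lebesgue \<le> ennreal K * Lp_norm (ennreal p1) f lebesgue * Lp_norm (ennreal p2) g lebesgue"
      using K(1) N by (simp add: ennreal_mult)
  qed
next
  case False
  then obtain r where r: "p3 = ennreal r" "0 \<le> r" by (cases p3) auto
  \<comment> \<open>For p = 1 the conjugate exponent is infinite, which a finite p3 cannot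
    reach.\<close>
  have p1: "1 < p" using assms False by (cases "p = 1") (auto simp: conj_exp_def top_unique)
  then have pr: "p / (p - 1) \<le> r" using assms(6) r by (simp add: conj_exp_def)
  have "2 \<le> p / (p - 1)" using p1 assms(5) by (simp add: field_simps)
  with pr have r2: "2 \<le> r" by simp
  have "p \<le> r * (p - 1)" using pr p1 by (simp add: pos_divide_le_eq)
  \<comment> \<open>The hypothesis p3 \<ge> p' in the form \<sigma> \<le> 1 - 1/p.\<close>
  then have rp: "1 / r \<le> 1 - 1 / p" using p1 r2 by (simp add: field_simps)
  have "1 / p1 + 1 / p2 - 2 / p = 1 / r"
    using assms(7) r r2 by (simp add: inverse_ennreal inverse_eq_divide)
  from bilin_op_fourier_majorant[OF assms(1-5) this rp assms(8)]
  obtain K where K: "K > 0" "\<forall>f\<in>P_class. \<forall>g\<in>P_class. \<exists>N1\<ge>0. \<exists>N2\<ge>0. \<exists>F G.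
      Lp_norm (ennreal p1) f lebesgue = ennreal N1 \<and> Lp_norm (ennreal p2) g lebesgue = ennreal N2 \<and>
      integrable lborel F \<and> unit_mass G \<and> bilin_op m f g = (\<lambda>x. fourier F (- x)) \<and>
      (AE t in lborel. norm (F t) \<le> K * N1 * N2 * G t powr (1 - 1 / r))"
    by blast
  \<comment> \<open>The conjugate of r: then 1/q = 1 - 1/r is precisely the exponent of the
    majorant, and r \<ge> 2 places q in the range of Hausdorff-Young.\<close>
  define q where "q = r / (r - 1)"
  have q: "1 < q" "q \<le> 2" "1 / q = 1 - 1 / r" "q / (q - 1) = r"
    using r2 by (auto simp: q_def field_simps)
  obtain C where C: "C > 0" "\<forall>F G N. integrable lborel F \<longrightarrow> unit_mass G \<longrightarrow> 0 \<le> N \<longrightarrow>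
    (AE t in lborel. norm (F t) \<le> N * G t powr (1 - 1 / r)) \<longrightarrow>
    (\<integral>\<^sup>+\<xi>. ennreal (norm (fourier F \<xi>) powr r) \<partial>lborel) \<le> ennreal (C * N powr r)"
    using hausdorff_young_scaled[OF q(1,2), unfolded q(3,4)] by blast
  show ?thesis unfolding BM_def
  proof (intro exI[of _ "C powr (1 / r) * K"] conjI ballI)
    show "0 < C powr (1 / r) * K" using C K by simp
    fix f g assume "f \<in> P_class" "g \<in> P_class"
    from bspec[OF bspec[OF K(2) this(1)] this(2)] obtain N1 N2 F G where N: "0 \<le> N1" "0 \<le> N2"
      "Lp_norm (ennreal p1) f lebesgue = ennreal N1" "Lp_norm (ennreal p2) g lebesgue = ennreal N2"
      and F: "integrable lborel F"
      and B: "bilin_op m f g = (\<lambda>x. fourier F (- x))"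
      and UG: "unit_mass G"
      and le: "AE t in lborel. norm (F t) \<le> K * N1 * N2 * G t powr (1 - 1 / r)" by blast
    have [measurable]: "F \<in> borel_measurable borel" using F by (auto dest: borel_measurable_integrable)
    note [measurable] = fourier_measurable[of F]
    have KN: "0 \<le> K * N1 * N2" using K(1) N by simp
    define I where "I = (\<integral>\<^sup>+x. ennreal (norm (bilin_op m f g x) powr r) \<partial>lborel)"
    have "I = (\<integral>\<^sup>+\<xi>. ennreal (norm (fourier F \<xi>) powr r) \<partial>lborel)"
      unfolding I_def B using nn_integral_real_affine[of "\<lambda>\<xi>. ennreal (norm (fourier F \<xi>) powr r)" "-1" 0] by simp
    also have "\<dots> \<le> ennreal (C * (K * N1 * N2) powr r)"
      by (rule C(2)[rule_format, OF F UG KN le])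
    finally have I: "I \<le> ennreal (C * (K * N1 * N2) powr r)" .
    \<comment> \<open>Finiteness selects the branch of \<open>Lp_norm\<close> that takes the r-th
      root.\<close>
    then have "I \<noteq> \<infinity>" by (auto simp: top_unique)
    then have "Lp_norm p3 (bilin_op m f g) lebesgue = ennreal (enn2real I powr (1 / r))"
      using r2 by (simp add: r Lp_norm_ennreal Let_def flip: I_def)
    also have "\<dots> \<le> ennreal ((C * (K * N1 * N2) powr r) powr (1 / r))"
      using r2 C(1) I by (intro ennreal_leI powr_mono2 enn2real_leI) auto
    also have "(C * (K * N1 * N2) powr r) powr (1 / r) = C powr (1 / r) * (K * N1 * N2)"
      using C(1) K(1) N(1,2) r2 by (simp add: powr_mult powr_powr)
    also have "ennreal \<dots> = ennreal (C powr (1 / r) * K) * Lp_norm (ennreal p1) f lebesgue * Lp_norm (ennreal p2) g lebesgue"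
      using K(1) N by (simp add: ennreal_mult mult.assoc)
    finally show "Lp_norm p3 (bilin_op m f g) lebesgue \<le>
      ennreal (C powr (1 / r) * K) * Lp_norm (ennreal p1) f lebesgue * Lp_norm (ennreal p2) g lebesgue" .
  qed
qed

end
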